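(* Let $E$ be a real Banach space and $F$ a real Hilbert space with a Schauder basis $(b_i)_{i\in\mathbb N}$ that is both Besselian and Hilbertian, with biorthogonal functionals $(b_i^* )_{i\in\mathbb N}$. Let $\mathbb N=I_0\cup I_1$ with $I_0\cap I_1=\emptyset$, let $f_0:E\to\mathbb R$ and $G:E\to F$ be of class $C^1$, $g_i:=b_i^*\circ G$, $K=\{y\in F\mid b_i^*(y)=0,\ i\in I_0,\ b_i^*(y)\le 0,\ i\in I_1\}$ and $$\mathcal F=\{x\in E\mid G(x)\in K\}=\{x\in E\mid g_i(x)=0,\ i\in I_0,\ g_i(x)\le 0,\ i\in I_1\}.$$ Let $x_0\in\mathcal F$ be a local minimizer of $f_0$ over $\mathcal F$. Assume that (i) the Relaxed Constant Rank Constraint Qualification Plus (RCRCQ+) holds for $\mathcal F$ at $x_0$ with a neighbourhood $V(x_0)$; (ii) for all $d\in\Gamma_{\mathcal F}(x_0)$ and for any function $r:(0,1)\to E$ with $\|r(t)\|t^{-1}\to 0$ as $t\downarrow 0$, there exists $\varepsilon_0>0$ such that $g_i(x_0+td+r(t))\le 0$ for all $i\in I_1\setminus I(x_0,d)$ and all $t\in(0,\varepsilon_0)$, where $I(x_0,d):=\{i\in I(x_0)\mid Dg_i(x_0)d=0\}$; (iii) the set $\mathcal M(x_0,0):=DG(x_0)^*\,\mathcal N_K(G(x_0))\subset E^*$ is weakly* closed. Then the set of Lagrange multipliers at $x_0$ is nonempty, i.e. there exists $\lambda\in\mathcal N_K(G(x_0))$ with $Df_0(x_0)+DG(x_0)^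*\lambda=0$.
   Context: Schauder basis of a Banach space $X$: a sequence $(v_i)$ such that every $x\in X$ has a unique expansion $x=\sum_i a_iv_i$ (for finite-dimensional $X$, a linear basis); the biorthogonal functionals $v_i^*\in X^*$ satisfy $v_i^*(v_j)=\delta_{ij}$, $x=\sum_i v_i^*(x)v_i$. A basis $(c_i)$ is Besselian if convergence of $\sum_i\alpha_ic_i$ implies $\sum_i\alpha_i^2<\infty$, and Hilbertian if $\sum_i\alpha_i^2<\infty$ implies convergence of $\sum_i\alpha_ic_i$. It is boundedly-complete if $\sup_N\|\sum_{i\le N}a_iv_i\|<\infty$ implies convergence of $\sum a_iv_i$, and shrinking if $(v_i^* )$ is a basis of $X^*$. $\overline{\operatorname{span}}$ is the norm-closed linear span. Tangent (Bouligand) cone to a set $Q$ at $x\in Q$: $\mathcal T_Q(x)=\{d\mid \exists\, (x_k)\subset Q,\ t_k\downarrow 0,\ x_k\to x,\ (x_k-x)/t_k\to d\}$. Linearized cone: $\Gamma_{\mathcal F}(x)=\{d\in E\mid DG(x)d\in\mathcal T_K(G(x))\}$. Active inequality indices: $I(x)=\{i\in I_1\mid g_i(x)=0\}$. Normal cone: $\mathcal N_K(\bar y)=\{y\in F\mid\langle y\mid k-\bar y\rangle\le 0\ \forall k\in K\}$. $DG(x_0)^*:F\to E^*$ is the adjoint of $DG(x_0)$. With the Lagrangian $L(x,\lambda)=f_0(x)+\langle\lambda\mid G(x)\rangle$, a Lagrange multiplier at $x_0$ is $\lambda\in\mathcal N_K(G(x_0))$ with $D_xL(x_0,\lambda)=0$.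 For $J=\{j_1<j_2<\dots\}\subset\mathbb N$: $Y(J)=\{(c_i)_{i\in J}\mid\sum_{i\in J}c_ib_i\text{ converges in }F\}$ with norm $\sup_N\|\sum_{k=1}^Nc_{j_k}b_{j_k}\|$. CRC+ (Constant Rank Condition Plus) for $(g_i)_{i\in J}$ at $x_0$ with neighbourhood $V(x_0)$ and index set $J_2\subset J$ means: 1. $(Dg_i(x))_{i\in J_2}$ is a Schauder basis of $\overline{\operatorname{span}}(Dg_i(x),\,i\in J)\subset E^*$ for all $x\in V(x_0)$; 2. for every $x\in V(x_0)$ there is a (linear) topological isomorphism $z_x:\overline{\operatorname{span}}(Dg_i(x),i\in J_2)\to\overline{\operatorname{span}}(Dg_i(x_0),i\in J_2)$ with $z_x(Dg_i(x))=Dg_i(x_0)$, $i\in J_2$; 3. $(Dg_i(x_0))_{i\in J_2}(E)=\{(Dg_i(x_0)e)_{i\in J_2}\mid e\in E\}$ is closed in $Y(J_2)$; 4. $(Dg_i(x_0))_{i\in J_2}$ is a shrinking and boundedly-complete basis of $X_1:=\overline{\operatorname{span}}(Dg_i(x_0),i\in J)$; 5. $(Dg_i(x_0))_{i\in J_2}$ is Besselian for $X_1$; 6. $Dg_i(x_0)^*\in E$ for $i\in J_2$, where $Dg_i(x_0)^*\in X_1^*$ are the functionals biorthogonal to the basis $(Dg_i(x_0))_{i\in J_2}$ of $X_1$; i.e. each $Dg_i(x_0)^*$ is evaluation of elements of $X_1\subset E^*$ at an element of $E$. RCRCQ+ holds for $\mathcal F$ at $x_0$ (with neighbourhood $V(x_0)$)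 if there is a neighbourhood $V(x_0)$ such that for every $J$ with $I_0\subset J\subset I_0\cup I(x_0)$ there exists $J_2\subset J$ such that CRC+ holds for $(g_i)_{i\in J}$ at $x_0$ with neighbourhood $V(x_0)$ and index set $J_2$. *)

theory Defs
  imports "HOL-Analysis.Analysis"
begin

text \<open>
  A sequence indexed by a set \<open>J\<close> of natural numbers is represented by a function on all of
  \<open>nat\<close>, and coefficient families over \<open>J\<close> vanish off \<open>J\<close>. Thus the series over \<open>J\<close>, summed in
  increasing order of the indices, is the library series over \<open>nat\<close>. For finite \<open>J\<close> it is a
  finite sum, so that a Schauder basis is a linear basis.
\<close>

definition coeffs :: "nat set \<Rightarrow> (nat \<Rightarrow> real) set" where
  "coeffs J = {a. \<forall>i. i \<notin> J \<longrightarrow> a i = 0}"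

definition schauder_basis :: "nat set \<Rightarrow> (nat \<Rightarrow> 'v::real_normed_vector) \<Rightarrow> 'v set \<Rightarrow> bool" where
  "schauder_basis J v X \<longleftrightarrow>
     subspace X \<and> closed X \<and> (\<forall>i\<in>J. v i \<in> X) \<and>
     (\<forall>x\<in>X. \<exists>!a. a \<in> coeffs J \<and> (\<lambda>i. a i *\<^sub>R v i) sums x)"

text \<open>The biorthogonal functional \<open>v\<^sub>i\<^sup>*\<close>; meaningful on the space spanned by the basis only.\<close>

definition biorth :: "nat set \<Rightarrow> (nat \<Rightarrow> 'v::real_normed_vector) \<Rightarrow> nat \<Rightarrow> 'v \<Rightarrow> real" where
  "biorth J v i x = (THE a. a \<in> coeffs J \<and> (\<lambda>k. a k *\<^sub>R v k) sums x) i"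

definition besselian :: "nat set \<Rightarrow> (nat \<Rightarrow> 'v::real_normed_vector) \<Rightarrow> bool" where
  "besselian J v \<longleftrightarrow>
     (\<forall>a\<in>coeffs J. summable (\<lambda>i. a i *\<^sub>R v i) \<longrightarrow> summable (\<lambda>i. (a i)\<^sup>2))"

definition hilbertian :: "nat set \<Rightarrow> (nat \<Rightarrow> 'v::real_normed_vector) \<Rightarrow> bool" where
  "hilbertian J v \<longleftrightarrow>
     (\<forall>a\<in>coeffs J. summable (\<lambda>i. (a i)\<^sup>2) \<longrightarrow> summable (\<lambda>i. a i *\<^sub>R v i))"

definition boundedly_complete :: "nat set \<Rightarrow> (nat \<Rightarrow> 'v::real_normed_vector) \<Rightarrow> bool" where
  "boundedly_complete J v \<longleftrightarrow>
     (\<forall>a\<in>coeffs J. bounded (range (\<lambda>N. \<Sum>i<N. a i *\<^sub>R v i)) \<longrightarrow> summable (\<lambda>i. a i *\<^sub>R v i))"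

text \<open>
  The dual of a subspace \<open>X\<close>: its elements are represented by functions on the whole type, of
  which only the restriction to \<open>X\<close> matters; the dual norm only sees this restriction.
\<close>

definition linear_on :: "'v::real_vector set \<Rightarrow> ('v \<Rightarrow> 'w::real_vector) \<Rightarrow> bool" where
  "linear_on X f \<longleftrightarrow>
     (\<forall>x\<in>X. \<forall>y\<in>X. f (x + y) = f x + f y) \<and> (\<forall>c. \<forall>x\<in>X. f (c *\<^sub>R x) = c *\<^sub>R f x)"

definition dual_on :: "'v::real_normed_vector set \<Rightarrow> ('v \<Rightarrow> real) set" where
  "dual_on X = {\<phi>. linear_on X \<phi> \<and> (\<exists>B. \<forall>x\<in>X. \<bar>\<phi> x\<bar> \<le> B * norm x)}"

definition dual_norm_on :: "'v::real_normed_vector set \<Rightarrow> ('v \<Rightarrow> real) \<Rightarrow> real" where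
  "dual_norm_on X \<phi> = (SUP x\<in>{x \<in> X. norm x \<le> 1}. \<bar>\<phi> x\<bar>)"

definition shrinking :: "nat set \<Rightarrow> (nat \<Rightarrow> 'v::real_normed_vector) \<Rightarrow> 'v set \<Rightarrow> bool" where
  "shrinking J v X \<longleftrightarrow>
     (\<forall>i\<in>J. biorth J v i \<in> dual_on X) \<and>
     (\<forall>\<phi>\<in>dual_on X. \<exists>!a. a \<in> coeffs J \<and>
        (\<lambda>N. dual_norm_on X (\<lambda>x. \<phi> x - (\<Sum>i<N. a i * biorth J v i x))) \<longlonglongrightarrow> 0)"

text \<open>
  Since \<open>c\<close> vanishes off \<open>J\<close>, the partial sums below take the same values as those along the
  increasing enumeration of \<open>J\<close> (and the value 0).
\<close>

definition Y_space :: "(nat \<Rightarrow> 'v::real_normed_vector) \<Rightarrow> nat set \<Rightarrow> (nat \<Rightarrow> real) set" where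
  "Y_space b J = {c \<in> coeffs J. summable (\<lambda>i. c i *\<^sub>R b i)}"

definition Y_norm :: "(nat \<Rightarrow> 'v::real_normed_vector) \<Rightarrow> (nat \<Rightarrow> real) \<Rightarrow> real" where
  "Y_norm b c = (SUP N. norm (\<Sum>i<N. c i *\<^sub>R b i))"

definition Y_topology :: "(nat \<Rightarrow> 'v::real_normed_vector) \<Rightarrow> nat set \<Rightarrow> (nat \<Rightarrow> real) topology" where
  "Y_topology b J =
     Metric_space.mtopology (Y_space b J) (\<lambda>c d. Y_norm b (\<lambda>i. c i - d i))"

definition fderiv :: "('a::real_normed_vector \<Rightarrow> 'b::real_normed_vector) \<Rightarrow> 'a \<Rightarrow> 'a \<Rightarrow>\<^sub>L 'b" where
  "fderiv f x = Blinfun (frechet_derivative f (at x))"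

definition C1_map :: "('a::real_normed_vector \<Rightarrow> 'b::real_normed_vector) \<Rightarrow> bool" where
  "C1_map f \<longleftrightarrow> (\<forall>x. f differentiable (at x)) \<and> continuous_on UNIV (fderiv f)"

text \<open>The adjoint \<open>F \<rightarrow> E\<^sup>*\<close> of an operator \<open>E \<rightarrow> F\<close>, the Hilbert space \<open>F\<close> being identified with its dual.\<close>

definition adj :: "('a::real_normed_vector \<Rightarrow>\<^sub>L 'b::real_inner) \<Rightarrow> 'b \<Rightarrow> 'a \<Rightarrow>\<^sub>L real" where
  "adj A y = blinfun_inner_right y o\<^sub>L A"

text \<open>
  For scalar-valued operators the strong operator topology is the topology of pointwise
  convergence on the dual space, i.e. the weak* topology.
\<close>

abbreviation weak_star_topology :: "('a::real_normed_vector \<Rightarrow>\<^sub>L real) topology" where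
  "weak_star_topology \<equiv> strong_operator_topology"

definition tangent_cone :: "'a::real_normed_vector set \<Rightarrow> 'a \<Rightarrow> 'a set" where
  "tangent_cone Q x = {d. \<exists>(xs :: nat \<Rightarrow> 'a) (t :: nat \<Rightarrow> real).
     (\<forall>k. xs k \<in> Q) \<and> (\<forall>k. 0 < t k) \<and> t \<longlonglongrightarrow> 0 \<and> xs \<longlonglongrightarrow> x \<and>
     (\<lambda>k. (xs k - x) /\<^sub>R t k) \<longlonglongrightarrow> d}"

definition normal_cone :: "'b::real_inner set \<Rightarrow> 'b \<Rightarrow> 'b set" where
  "normal_cone K y = {l. \<forall>k\<in>K. l \<bullet> (k - y) \<le> 0}"

definition linearized_cone ::
  "'b::real_normed_vector set \<Rightarrow> ('a::real_normed_vector \<Rightarrow> 'b) \<Rightarrow> 'a \<Rightarrow> 'a set" where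
  "linearized_cone K G x = {d. blinfun_apply (fderiv G x) d \<in> tangent_cone K (G x)}"

definition lagrangian ::
  "('a::real_normed_vector \<Rightarrow> real) \<Rightarrow> ('a \<Rightarrow> 'b::real_inner) \<Rightarrow> 'a \<Rightarrow> 'b \<Rightarrow> real" where
  "lagrangian f\<^sub>0 G x l = f\<^sub>0 x + l \<bullet> G x"

definition lagrange_multipliers ::
  "('a::real_normed_vector \<Rightarrow> real) \<Rightarrow> ('a \<Rightarrow> 'b::real_inner) \<Rightarrow> 'b set \<Rightarrow> 'a \<Rightarrow> 'b set" where
  "lagrange_multipliers f\<^sub>0 G K x =
     {l \<in> normal_cone K (G x). fderiv (\<lambda>x'. lagrangian f\<^sub>0 G x' l) x = 0}"

definition local_minimizer_on :: "('a::metric_space \<Rightarrow> real) \<Rightarrow> 'a set \<Rightarrow> 'a \<Rightarrow> bool" where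
  "local_minimizer_on f S x \<longleftrightarrow>
     x \<in> S \<and> (\<exists>\<delta>>0. \<forall>y\<in>S. dist y x < \<delta> \<longrightarrow> f x \<le> f y)"

text \<open>Below, \<open>bs i\<close> stands for the biorthogonal functional \<open>b\<^sub>i\<^sup>* \<in> F\<^sup>*\<close>.\<close>

definition constr ::
  "(nat \<Rightarrow> 'f::real_normed_vector \<Rightarrow>\<^sub>L real) \<Rightarrow> ('e \<Rightarrow> 'f) \<Rightarrow> nat \<Rightarrow> 'e \<Rightarrow> real" where
  "constr bs G i x = blinfun_apply (bs i) (G x)"

definition constraint_cone ::
  "(nat \<Rightarrow> 'f::real_normed_vector \<Rightarrow>\<^sub>L real) \<Rightarrow> nat set \<Rightarrow> nat set \<Rightarrow> 'f set" where
  "constraint_cone bs I\<^sub>0 I\<^sub>1 =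
     {y. (\<forall>i\<in>I\<^sub>0. blinfun_apply (bs i) y = 0) \<and> (\<forall>i\<in>I\<^sub>1. blinfun_apply (bs i) y \<le> 0)}"

definition active :: "(nat \<Rightarrow> 'e \<Rightarrow> real) \<Rightarrow> nat set \<Rightarrow> 'e \<Rightarrow> nat set" where
  "active g I\<^sub>1 x = {i \<in> I\<^sub>1. g i x = 0}"

definition active_dir ::
  "(nat \<Rightarrow> 'e::real_normed_vector \<Rightarrow> real) \<Rightarrow> nat set \<Rightarrow> 'e \<Rightarrow> 'e \<Rightarrow> nat set" where
  "active_dir g I\<^sub>1 x d = {i \<in> active g I\<^sub>1 x. blinfun_apply (fderiv (g i) x) d = 0}"

definition closed_span :: "'v::real_normed_vector set \<Rightarrow> 'v set" where
  "closed_span S = closure (span S)"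

definition CRC_plus ::
  "(nat \<Rightarrow> 'f::real_normed_vector) \<Rightarrow> (nat \<Rightarrow> 'e::real_normed_vector \<Rightarrow> real) \<Rightarrow> 'e \<Rightarrow> 'e set \<Rightarrow>
   nat set \<Rightarrow> nat set \<Rightarrow> bool" where
  "CRC_plus b g x\<^sub>0 V J J\<^sub>2 \<longleftrightarrow>
     (let Dg = (\<lambda>x i. fderiv (g i) x); X\<^sub>1 = closed_span (Dg x\<^sub>0 ` J) in
      J\<^sub>2 \<subseteq> J \<and>
      (\<forall>x\<in>V. schauder_basis J\<^sub>2 (Dg x) (closed_span (Dg x ` J))) \<and>
      (\<forall>x\<in>V. \<exists>z w. linear_on (closed_span (Dg x ` J\<^sub>2)) z \<and>
         homeomorphism (closed_span (Dg x ` J\<^sub>2)) (closed_span (Dg x\<^sub>0 ` J\<^sub>2)) z w \<and>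
         (\<forall>i\<in>J\<^sub>2. z (Dg x i) = Dg x\<^sub>0 i)) \<and>
      closedin (Y_topology b J\<^sub>2)
        (range (\<lambda>e i. if i \<in> J\<^sub>2 then blinfun_apply (Dg x\<^sub>0 i) e else 0)) \<and>
      schauder_basis J\<^sub>2 (Dg x\<^sub>0) X\<^sub>1 \<and> shrinking J\<^sub>2 (Dg x\<^sub>0) X\<^sub>1 \<and> boundedly_complete J\<^sub>2 (Dg x\<^sub>0) \<and>
      besselian J\<^sub>2 (Dg x\<^sub>0) \<and>
      (\<forall>i\<in>J\<^sub>2. \<exists>e. \<forall>\<phi>\<in>X\<^sub>1. biorth J\<^sub>2 (Dg x\<^sub>0) i \<phi> = blinfun_apply \<phi> e))"

definition RCRCQ_plus ::
  "(nat \<Rightarrow> 'f::real_normed_vector) \<Rightarrow> (nat \<Rightarrow> 'e::real_normed_vector \<Rightarrow> real) \<Rightarrow>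
   nat set \<Rightarrow> nat set \<Rightarrow> 'e \<Rightarrow> 'e set \<Rightarrow> bool" where
  "RCRCQ_plus b g I\<^sub>0 I\<^sub>1 x\<^sub>0 V \<longleftrightarrow>
     x\<^sub>0 \<in> interior V \<and>
     (\<forall>J. I\<^sub>0 \<subseteq> J \<and> J \<subseteq> I\<^sub>0 \<union> active g I\<^sub>1 x\<^sub>0 \<longrightarrow> (\<exists>J\<^sub>2\<subseteq>J. CRC_plus b g x\<^sub>0 V J J\<^sub>2))"

end

theory Submission
  imports Defs
begin

text \<open>
  The overall scheme is the classical one. Suppose that \<open>Df\<^sub>0(x\<^sub>0) d \<ge> 0\<close> for every linearized
  direction \<open>d\<close>. If \<open>- Df\<^sub>0(x\<^sub>0)\<close> were not in \<open>M = DG(x\<^sub>0)\<^sup>* N\<close>, where \<open>N\<close> is the normal cone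
  of \<open>K\<close> at \<open>G(x\<^sub>0)\<close>, then, \<open>M\<close> being a weak* closed convex cone, a point \<open>d\<close> of the space
  itself would separate the two (\<open>weak_star_separation\<close>): \<open>Df\<^sub>0(x\<^sub>0) d < 0\<close> and \<open>DG(x\<^sub>0) d\<close> lies
  in the polar of \<open>N\<close>. By the bipolar theorem (\<open>polar_of_normal_cone_tangent\<close>) \<open>DG(x\<^sub>0) d\<close> is
  tangent to \<open>K\<close>, so \<open>d\<close> is a linearized direction, a contradiction.

  What remains is to realise each linearized direction \<open>d\<close> by a feasible curve
  \<open>x\<^sub>0 + t d + r(t)\<close> with \<open>r(t) = o(t)\<close> (\<open>constant_rank_curve\<close>). Let \<open>J\<close> consist of the equality
  constraints and of those active constraints whose derivative vanishes along \<open>d\<close>. The other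
  constraints are taken care of by the hypothesis on inactive indices, so the curve has to
  satisfy \<open>g\<^sub>i = 0\<close> for all \<open>i \<in> J\<close>, possibly infinitely many \<open>i\<close> at once. Let \<open>J\<^sub>2 \<subseteq> J\<close> be the
  index set of the basis in the constant rank condition, and let \<open>H\<close> be the map with the
  coordinates \<open>g\<^sub>j\<close>, \<open>j \<in> J\<^sub>2\<close>. Three facts give the curve.

  First, \<open>DH(x\<^sub>0)\<close> maps onto the space \<open>W\<close> spanned by the \<open>b\<^sub>j\<close>, \<open>j \<in> J\<^sub>2\<close>, because its adjoint is
  bounded below (\<open>adjoint_bounded_below\<close>). This is where bounded completeness, the Besselian
  property and the evaluation form of the biorthogonal functionals enter.

  Second, since \<open>DH(x\<^sub>0)\<close> is onto, a Newton-like iteration moves \<open>x\<^sub>0 + t d\<close> into the level set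
  \<open>H = H(x\<^sub>0)\<close> at the cost of \<open>o(t)\<close>. This is Lyusternik's theorem (\<open>Ljusternik_curve\<close>).

  Third, every \<open>g\<^sub>i\<close> with \<open>i \<in> J\<close> is constant on the level set near \<open>x\<^sub>0\<close>, because \<open>Dg\<^sub>i(x)\<close> lies in
  the closed span of the \<open>Dg\<^sub>j(x)\<close>, \<open>j \<in> J\<^sub>2\<close>, and therefore vanishes on the kernel of \<open>DH(x)\<close>
  (\<open>constant_on_level\<close>). The kernel need not be complemented, so
  the implicit function theorem need not provide a parametrisation of the level set or smooth
  paths in it. Instead, a point of the level set is transported to \<open>x\<^sub>0\<close> inside the level set by
  infinitely many small jumps of finite total length, chosen so that \<open>g\<^sub>i\<close> changes by at most
  \<open>\<epsilon>\<close> times the length of each jump; as \<open>\<epsilon>\<close> is arbitrary, \<open>g\<^sub>i\<close> does not change. The radius in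
  which this works depends on \<open>H\<close> and \<open>V\<close> only, hence is the same for all \<open>i \<in> J\<close>.
\<close>

section \<open>Two consequences of Baire's theorem\<close>

text \<open>
  The absorbing set \<open>B\<close> covers \<open>W\<close> by its multiples, so by Baire's theorem some multiple has an
  interior point relative to \<open>W\<close>; symmetry and convexity move this interior point to the origin.
\<close>

lemma barrel_contains_ball:
  fixes W B :: "'a::banach set"
  assumes W: "subspace W" "closed W"
    and B: "closed B" "convex B" "\<And>x. x \<in> B \<Longrightarrow> - x \<in> B"
    and absorb: "\<And>x. x \<in> W \<Longrightarrow> \<exists>s>0. s *\<^sub>R x \<in> B"
  obtains r where "0 < r" "cball 0 r \<inter> W \<subseteq> B"
proof -
  let ?X = "top_of_set W"
  define T where "T n = W \<inter> {x. x /\<^sub>R real (Suc n) \<in> B}" for n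
  have zero: "0 \<in> B"
    using absorb[OF subspace_0[OF W(1)]] by simp
  have closed_T: "closedin ?X (T n)" for n
  proof -
    have "closed ((\<lambda>x. x /\<^sub>R real (Suc n)) -` B)"
      by (intro continuous_closed_vimage B continuous_intros)
    then show ?thesis
      unfolding T_def vimage_def by (intro closedin_closed_Int)
  qed
  have cover: "\<Union> (range T) = W"
  proof -
    have "\<exists>n. x \<in> T n" if x: "x \<in> W" for x
    proof -
      obtain s where s: "s > 0" "s *\<^sub>R x \<in> B"
        using absorb x by blast
      obtain n where "1 / s < real n"
        using reals_Archimedean2 by blast
      then have "1 / s \<le> real (Suc n)" by simp
      then have le: "1 / (s * real (Suc n)) \<le> 1"
        using s by (simp add: field_simps)
      have "(1 - 1 / (s * real (Suc n))) *\<^sub>R 0 + (1 / (s * real (Suc n))) *\<^sub>R (s *\<^sub>R x) \<in> B"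
        using le s by (intro convexD[OF B(2) zero s(2)]) auto
      moreover have "(1 / (s * real (Suc n))) * s = inverse (real (Suc n))"
        using s by (simp add: field_simps del: of_nat_Suc)
      ultimately show ?thesis
        using x by (auto simp: T_def)
    qed
    then show ?thesis by (auto simp: T_def)
  qed
  have "\<exists>n. ?X interior_of T n \<noteq> {}"
  proof (rule ccontr)
    assume "\<not> ?thesis"
    then have "?X interior_of \<Union> (range T) = {}"
      using W(2) closed_T
      by (intro Baire_category_alt disjI1 completely_metrizable_space_closedin
          [OF completely_metrizable_space_euclidean]) auto
    then show False
      using cover subspace_0[OF W(1)] by (metis empty_iff interior_of_topspace topspace_euclidean_subtopology)
  qed
  then obtain n x where "x \<in> ?X interior_of T n" by blast
  then obtain U where U: "openin ?X U" "x \<in> U" "U \<subseteq> T n"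
    unfolding interior_of_def by blast
  then obtain e where e: "e > 0" "ball x e \<inter> W \<subseteq> T n"
    using openin_contains_ball[of W U] by blast
  have xW: "x \<in> W" using U by (auto simp: T_def)
  let ?n = "real (Suc n)"
  have "u \<in> B" if u: "u \<in> cball 0 (e / (2 * ?n)) \<inter> W" for u
  proof -
    have v: "norm (?n *\<^sub>R u) < e"
    proof -
      have "?n * norm u \<le> ?n * (e / (2 * ?n))"
        using u by (intro mult_left_mono) auto
      also have "\<dots> = e / 2" by (simp add: field_simps del: of_nat_Suc)
      also have "\<dots> < e" using e by simp
      finally show ?thesis by simp
    qed
    have "x + ?n *\<^sub>R u \<in> ball x e \<inter> W" "x - ?n *\<^sub>R u \<in> ball x e \<inter> W"
      using v u xW W(1) by (auto simp: dist_norm subspace_add subspace_diff subspace_scale simp del: of_nat_Suc)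
    then have "x + ?n *\<^sub>R u \<in> T n" "x - ?n *\<^sub>R u \<in> T n"
      using e(2) by blast+
    then have "(x + ?n *\<^sub>R u) /\<^sub>R ?n \<in> B" "- ((x - ?n *\<^sub>R u) /\<^sub>R ?n) \<in> B"
      using B(3) by (auto simp: T_def simp del: of_nat_Suc)
    \<comment> \<open>\<open>u\<close> is the midpoint of \<open>(x + n u) / n\<close> and \<open>- (x - n u) / n\<close>, both of which lie in \<open>B\<close>.\<close>
    then have "(1/2) *\<^sub>R ((x + ?n *\<^sub>R u) /\<^sub>R ?n) + (1/2) *\<^sub>R (- ((x - ?n *\<^sub>R u) /\<^sub>R ?n)) \<in> B"
      by (intro convexD[OF B(2)]) auto
    also have "(1/2) *\<^sub>R ((x + ?n *\<^sub>R u) /\<^sub>R ?n) + (1/2) *\<^sub>R (- ((x - ?n *\<^sub>R u) /\<^sub>R ?n)) = u"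
      by (simp add: scaleR_add_right scaleR_diff_right del: of_nat_Suc flip: scaleR_add_left)
    finally show ?thesis .
  qed
  then show thesis
    using e(1) by (intro that[of "e / (2 * ?n)"]) auto
qed

text \<open>
  The Banach-Steinhaus theorem on a closed subspace. Seminorms, instead of norms of operators,
  let one statement serve both partial sums of a basis expansion and Euclidean norms of finitely
  many coordinates.
\<close>

lemma uniform_boundedness_seminorms:
  fixes p :: "nat \<Rightarrow> 'a::banach \<Rightarrow> real"
  assumes X: "subspace X" "closed X"
    and cont: "\<And>n. continuous_on UNIV (p n)"
    and sub: "\<And>n x y. p n (x + y) \<le> p n x + p n y"
    and hom: "\<And>n c x. p n (c *\<^sub>R x) = \<bar>c\<bar> * p n x"
    and bdd: "\<And>x. x \<in> X \<Longrightarrow> \<exists>M. \<forall>n. p n x \<le> M"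
  obtains M where "M > 0" "\<And>n x. x \<in> X \<Longrightarrow> p n x \<le> M * norm x"
proof -
  define B where "B = {x. \<forall>n. p n x \<le> 1}"
  obtain r where r: "0 < r" "cball 0 r \<inter> X \<subseteq> B"
  proof (rule barrel_contains_ball[of X B])
    have "closed (\<Inter>n. {x. p n x \<le> 1})"
      by (intro closed_INT ballI closed_Collect_le cont continuous_on_const)
    then show "closed B" by (simp add: B_def Collect_all_eq)
    show "convex B"
    proof (rule convexI)
      fix x y and u v :: real
      assume *: "x \<in> B" "y \<in> B" "0 \<le> u" "0 \<le> v" "u + v = 1"
      have "p n (u *\<^sub>R x + v *\<^sub>R y) \<le> 1" for n
      proof -
        have "p n (u *\<^sub>R x + v *\<^sub>R y) \<le> u * p n x + v * p n y"
          using sub[of n "u *\<^sub>R x" "v *\<^sub>R y"] * by (simp add: hom)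
        also have "\<dots> \<le> u * 1 + v * 1"
          using * by (intro add_mono mult_left_mono) (auto simp: B_def)
        finally show ?thesis using * by simp
      qed
      then show "u *\<^sub>R x + v *\<^sub>R y \<in> B" by (simp add: B_def)
    qed
    show "- x \<in> B" if "x \<in> B" for x
      using that hom[of _ "-1" x] by (simp add: B_def)
    show "\<exists>s>0. s *\<^sub>R x \<in> B" if x: "x \<in> X" for x
    proof -
      obtain M where M: "\<And>n. p n x \<le> M" using bdd[OF x] by blast
      have pos: "\<bar>M\<bar> + 1 > 0" by (simp add: add_nonneg_pos)
      have "p n x \<le> \<bar>M\<bar> + 1" for n using M[of n] by linarith
      then have "(1 / (\<bar>M\<bar> + 1)) *\<^sub>R x \<in> B" using pos by (simp add: B_def hom field_simps)
      then show ?thesis using pos by (intro exI[of _ "1 / (\<bar>M\<bar> + 1)"]) auto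
    qed
  qed (use X in auto)
  have "p n x \<le> (1 / r) * norm x" if x: "x \<in> X" for n x
  proof (cases "x = 0")
    case True
    then show ?thesis using hom[of n 0 0] by simp
  next
    case False
    then have "(r / norm x) *\<^sub>R x \<in> cball 0 r \<inter> X"
      using r x X(1) by (simp add: subspace_scale)
    then have "(r / norm x) *\<^sub>R x \<in> B" by (rule subsetD[OF r(2)])
    then have "p n ((r / norm x) *\<^sub>R x) \<le> 1" by (simp add: B_def)
    then show ?thesis using r False by (simp add: hom field_simps)
  qed
  then show thesis using r by (intro that[of "1 / r"]) auto
qed

section \<open>Successive approximation and descent in complete spaces\<close>

text \<open>
  A linear map \<open>A\<close> that hits each target up to a quarter of its norm is enough to solve \<open>H x' = y\<close>:
  the defect left by \<open>A\<close> and the nonlinearity of \<open>H\<close> each cost a quarter, so every step halves the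
  residual, and the steps form a geometric series with sum at most \<open>2 C\<close> times the first residual.
  Allowing an approximate right inverse lets the same iteration yield exact surjectivity of
  linear maps (take \<open>H\<close> linear).
\<close>

lemma Graves_correction:
  fixes H :: "'e::banach \<Rightarrow> 'f::real_normed_vector" and A :: "'e \<Rightarrow>\<^sub>L 'f"
  assumes W: "subspace W" and C: "C > 0"
    and onto: "\<And>w. w \<in> W \<Longrightarrow> \<exists>e. norm e \<le> C * norm w \<and> norm (w - A e) \<le> norm w / 4"
    and range: "\<And>u. H u \<in> W" "y \<in> W"
    and strict: "\<And>u v. u \<in> S \<Longrightarrow> v \<in> S \<Longrightarrow> C * norm (H u - H v - A (u - v)) \<le> norm (u - v) / 4"
    and S: "cball x (2 * C * norm (y - H x)) \<subseteq> S"
  shows "\<exists>x'. H x' = y \<and> norm (x' - x) \<le> 2 * C * norm (y - H x)"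
proof -
  define R where "R = norm (y - H x)"
  obtain s where s: "\<And>w. w \<in> W \<Longrightarrow> norm (s w) \<le> C * norm w"
      "\<And>w. w \<in> W \<Longrightarrow> norm (w - A (s w)) \<le> norm w / 4"
    using onto by metis
  define u where "u = rec_nat x (\<lambda>_ v. v + s (y - H v))"
  have u_0: "u 0 = x" and u_Suc: "u (Suc k) = u k + s (y - H (u k))" for k
    by (simp_all add: u_def)
  have res_W: "y - H v \<in> W" for v
    using W range by (simp add: subspace_diff)
  have step: "norm (u (Suc k) - u k) \<le> C * norm (y - H (u k))" for k
    using s(1)[OF res_W] by (simp add: u_Suc)
  have inv: "norm (y - H (u k)) \<le> R * (1/2)^k \<and> norm (u k - x) \<le> 2 * C * R * (1 - (1/2)^k)" for k
  proof (induction k)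
    case 0
    then show ?case by (simp add: u_0 R_def)
  next
    case (Suc k)
    have dist: "norm (u (Suc k) - u k) \<le> C * (R * (1/2)^k)"
      using step[of k] mult_left_mono[OF conjunct1[OF Suc], of C] C by linarith
    have far: "norm (u (Suc k) - x) \<le> 2 * C * R * (1 - (1/2)^Suc k)"
    proof -
      have "norm (u (Suc k) - x) \<le> norm (u (Suc k) - u k) + norm (u k - x)"
        by (metis norm_triangle_ineq diff_add_cancel add_diff_eq)
      also have "\<dots> \<le> C * (R * (1/2)^k) + 2 * C * R * (1 - (1/2)^k)"
        using dist Suc by simp
      also have "\<dots> = 2 * C * R * (1 - (1/2)^Suc k)" by (simp add: algebra_simps)
      finally show ?thesis .
    qed
    have R: "R \<ge> 0" by (simp add: R_def)
    have in_S: "u k \<in> S" "u (Suc k) \<in> S"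
    proof -
      have *: "2 * C * R * (1 - (1/2)^j) \<le> 2 * C * R" for j
        using C R by (simp add: mult_left_le)
      show "u k \<in> S" "u (Suc k) \<in> S"
        using far Suc *[of k] *[of "Suc k"] S
        by (auto simp: subset_iff dist_norm norm_minus_commute R_def)
    qed
    let ?w = "y - H (u k)"
    have "y - H (u (Suc k)) = (?w - A (s ?w)) - (H (u (Suc k)) - H (u k) - A (u (Suc k) - u k))"
      by (simp add: u_Suc)
    then have "norm (y - H (u (Suc k))) \<le> norm (?w - A (s ?w))
        + norm (H (u (Suc k)) - H (u k) - A (u (Suc k) - u k))"
      by (metis norm_triangle_ineq4)
    moreover have "norm (H (u (Suc k)) - H (u k) - A (u (Suc k) - u k)) \<le> norm ?w / 4"
    proof -
      have "C * norm (H (u (Suc k)) - H (u k) - A (u (Suc k) - u k)) \<le> C * (norm ?w / 4)"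
        using strict[OF in_S(2,1)] step[of k] by linarith
      then show ?thesis using C by (simp only: mult_le_cancel_left_pos)
    qed
    moreover have "norm (?w - A (s ?w)) \<le> norm ?w / 4"
      by (rule s(2)[OF res_W])
    ultimately have "norm (y - H (u (Suc k))) \<le> R * (1/2)^Suc k"
      using Suc by simp
    then show ?case using far by blast
  qed
  have "summable (\<lambda>k. u (Suc k) - u k)"
  proof (rule summable_comparison_test')
    show "summable (\<lambda>k. C * R * (1/2::real)^k)"
      by (intro summable_mult summable_geometric) simp
    show "norm (u (Suc k) - u k) \<le> C * R * (1/2)^k" for k
      using step[of k] mult_left_mono[OF conjunct1[OF inv[of k]], of C] C by (simp only: mult.assoc) linarith
  qed
  then have "convergent u"
    using summable_iff_convergent[of "\<lambda>k. u (Suc k) - u k"] convergent_add_const_right_iff[of "\<lambda>n. u n - u 0" "u 0"]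
    by (simp add: sum_lessThan_telescope)
  then obtain l where l: "u \<longlonglongrightarrow> l" by (auto simp: convergent_def)
  have u_near: "norm (u k - x) \<le> 2 * C * R" for k
  proof -
    have "2 * C * R * (1 - (1/2)^k) \<le> 2 * C * R"
      using C by (simp add: R_def mult_left_le)
    then show ?thesis using inv[of k] by linarith
  qed
  have l_near: "norm (l - x) \<le> 2 * C * R"
    by (rule tendsto_upperbound[where F = sequentially and f = "\<lambda>k. norm (u k - x)"])
      (use l u_near in \<open>auto intro!: tendsto_intros\<close>)
  have in_S: "u k \<in> S" "l \<in> S" for k
    using u_near[of k] l_near S by (auto simp: subset_iff dist_norm norm_minus_commute R_def)
  have "(\<lambda>k. H (u k) - H l) \<longlonglongrightarrow> 0"
  proof (rule Lim_null_comparison)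
    show "\<forall>\<^sub>F k in sequentially. norm (H (u k) - H l) \<le> (norm A + 1 / (4 * C)) * norm (u k - l)"
    proof (rule always_eventually, rule)
      fix k
      have "norm (H (u k) - H l) \<le> norm (H (u k) - H l - A (u k - l)) + norm (A (u k - l))"
        by (metis norm_triangle_ineq diff_add_cancel)
      moreover have "norm (H (u k) - H l - A (u k - l)) \<le> norm (u k - l) / (4 * C)"
        using strict[OF in_S, of k] C by (simp add: field_simps)
      moreover have "norm (A (u k - l)) \<le> norm A * norm (u k - l)"
        by (rule norm_blinfun)
      ultimately show "norm (H (u k) - H l) \<le> (norm A + 1 / (4 * C)) * norm (u k - l)"
        by (simp add: algebra_simps)
    qed
    show "(\<lambda>k. (norm A + 1 / (4 * C)) * norm (u k - l)) \<longlonglongrightarrow> 0"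
      using l by (intro tendsto_mult_right_zero tendsto_norm_zero LIM_zero)
  qed
  then have "(\<lambda>k. H (u k)) \<longlonglongrightarrow> H l" by (rule LIM_zero_cancel)
  moreover have "(\<lambda>k. H (u k)) \<longlonglongrightarrow> y"
  proof -
    have "(\<lambda>k. y - H (u k)) \<longlonglongrightarrow> 0"
    proof (rule Lim_null_comparison)
      show "\<forall>\<^sub>F k in sequentially. norm (y - H (u k)) \<le> R * (1/2)^k" using inv by simp
      show "(\<lambda>k. R * (1/2)^k) \<longlonglongrightarrow> 0"
        by (intro tendsto_mult_right_zero LIMSEQ_realpow_zero) auto
    qed
    then show ?thesis using tendsto_diff[of "\<lambda>_. y" y sequentially "\<lambda>k. y - H (u k)" 0] by simp
  qed
  ultimately have "H l = y" by (rule LIMSEQ_unique)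
  then show ?thesis using l_near by (auto simp: R_def)
qed

text \<open>
  If every point where \<open>\<phi>\<close> is positive admits a jump whose length is paid for by the decrease of
  \<open>\<phi>\<close>, then the zero set of \<open>\<phi>\<close> is reached by countably many jumps of total length at most \<open>\<phi> p\<close>.
  Each jump is chosen to gain at least half of what is possible, so that the limit admits no
  further jump.
\<close>

lemma Caristi_descent:
  fixes \<phi> :: "'a::metric_space \<Rightarrow> real"
  assumes S: "complete S" and cont: "continuous_on S \<phi>" and nonneg: "\<And>x. x \<in> S \<Longrightarrow> 0 \<le> \<phi> x"
    and descent: "\<And>x. x \<in> S \<Longrightarrow> 0 < \<phi> x \<Longrightarrow> \<exists>x'\<in>S. \<phi> x' < \<phi> x \<and> dist x' x \<le> \<phi> x - \<phi> x'"
    and p: "p \<in> S"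
  shows "\<exists>q\<in>S. \<phi> q = 0 \<and> dist q p \<le> \<phi> p"
proof -
  define R where "R x = {y \<in> S. dist y x \<le> \<phi> x - \<phi> y}" for x
  have trans: "z \<in> R x" if "y \<in> R x" "z \<in> R y" for x y z
    using that dist_triangle[of z x y] by (auto simp: R_def)
  have refl: "x \<in> R x" if "x \<in> S" for x
    using that by (simp add: R_def)
  have "\<exists>y\<in>R x. \<forall>z\<in>R x. \<phi> y \<le> (\<phi> x + \<phi> z) / 2" if x: "x \<in> S" for x
  proof -
    define m where "m = Inf (\<phi> ` R x)"
    have bdd: "bdd_below (\<phi> ` R x)"
      using nonneg by (intro bdd_belowI[of _ 0]) (auto simp: R_def)
    have m_le: "m \<le> \<phi> z" if "z \<in> R x" for z
      unfolding m_def using bdd that by (intro cInf_lower) auto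
    show ?thesis
    proof (cases "m = \<phi> x")
      case True
      then show ?thesis using refl[OF x] m_le by (intro bexI[of _ x]) force+
    next
      case False
      then have "m < (\<phi> x + m) / 2" using m_le[OF refl[OF x]] by simp
      then obtain y where "y \<in> R x" "\<phi> y < (\<phi> x + m) / 2"
        unfolding m_def using cInf_lessD[of "\<phi> ` R x"] refl[OF x] by blast
      then show ?thesis using m_le by (intro bexI[of _ y]) force+
    qed
  qed
  then obtain nxt where nxt: "\<And>x. x \<in> S \<Longrightarrow> nxt x \<in> R x"
      "\<And>x z. x \<in> S \<Longrightarrow> z \<in> R x \<Longrightarrow> \<phi> (nxt x) \<le> (\<phi> x + \<phi> z) / 2"
    by metis
  define u where "u n = (nxt ^^ n) p" for n
  have u_Suc: "u (Suc n) = nxt (u n)" for n by (simp add: u_def)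
  have u_S: "u n \<in> S" for n
  proof (induction n)
    case 0
    then show ?case using p by (simp add: u_def)
  next
    case (Suc n)
    then show ?case using nxt(1)[of "u n"] by (simp add: u_Suc R_def)
  qed
  have mono: "u n \<in> R (u m)" if "m \<le> n" for m n
    using that
  proof (induction n rule: dec_induct)
    case base
    then show ?case by (rule refl[OF u_S])
  next
    case (step n)
    then show ?case using nxt(1)[OF u_S, of n] trans by (auto simp: u_Suc)
  qed
  have "decseq (\<lambda>n. \<phi> (u n))"
  proof (intro decseq_SucI)
    fix n
    show "\<phi> (u (Suc n)) \<le> \<phi> (u n)"
    proof -
      have "dist (u (Suc n)) (u n) \<le> \<phi> (u n) - \<phi> (u (Suc n))"
        using mono[of n "Suc n"] by (simp add: R_def)
      then show ?thesis using zero_le_dist[of "u (Suc n)" "u n"] by linarith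
    qed
  qed
  then obtain c where c: "(\<lambda>n. \<phi> (u n)) \<longlonglongrightarrow> c"
    by (rule decseq_convergent[of _ 0]) (use nonneg u_S in auto)
  have "Cauchy u"
  proof (rule metric_CauchyI)
    fix e :: real assume "e > 0"
    then obtain M where M: "\<And>m n. m \<ge> M \<Longrightarrow> n \<ge> M \<Longrightarrow> dist (\<phi> (u m)) (\<phi> (u n)) < e"
      using LIMSEQ_imp_Cauchy[OF c] metric_CauchyD by blast
    have "dist (u m) (u n) < e" if "m \<ge> M" "n \<ge> M" for m n
      using M[OF that] mono[of m n] mono[of n m]
      by (cases "m \<le> n") (auto simp: R_def dist_commute dist_real_def)
    then show "\<exists>M. \<forall>m\<ge>M. \<forall>n\<ge>M. dist (u m) (u n) < e" by blast
  qed
  then obtain q where q: "q \<in> S" "u \<longlonglongrightarrow> q"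
    using S u_S by (meson completeE)
  have \<phi>_q: "(\<lambda>n. \<phi> (u n)) \<longlonglongrightarrow> \<phi> q"
    using continuous_on_tendsto_compose[OF cont q(2,1)] u_S by auto
  have q_R: "q \<in> R (u n)" for n
  proof -
    have "dist q (u n) \<le> \<phi> (u n) - \<phi> q"
    proof (rule tendsto_le[where F = sequentially])
      show "(\<lambda>k. \<phi> (u n) - \<phi> (u k)) \<longlonglongrightarrow> \<phi> (u n) - \<phi> q"
        using \<phi>_q by (intro tendsto_intros)
      show "(\<lambda>k. dist (u k) (u n)) \<longlonglongrightarrow> dist q (u n)"
        using q by (intro tendsto_intros)
      show "\<forall>\<^sub>F k in sequentially. dist (u k) (u n) \<le> \<phi> (u n) - \<phi> (u k)"
        using eventually_ge_at_top[of n]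
      proof (rule eventually_mono)
        show "dist (u k) (u n) \<le> \<phi> (u n) - \<phi> (u k)" if "n \<le> k" for k
          using mono[OF that] by (simp add: R_def)
      qed
    qed auto
    then show ?thesis using q by (simp add: R_def)
  qed
  have "\<phi> q = 0"
  proof (rule ccontr)
    assume "\<phi> q \<noteq> 0"
    then obtain x' where x': "x' \<in> S" "\<phi> x' < \<phi> q" "dist x' q \<le> \<phi> q - \<phi> x'"
      using descent[OF q(1)] nonneg[OF q(1)] by force
    then have "x' \<in> R (u n)" for n
      using trans[OF q_R] by (simp add: R_def)
    then have "\<phi> (u (Suc n)) \<le> (\<phi> (u n) + \<phi> x') / 2" for n
      using nxt(2)[OF u_S] by (simp add: u_Suc)
    then have "\<phi> q \<le> (\<phi> q + \<phi> x') / 2"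
      by (intro LIMSEQ_le[OF LIMSEQ_Suc[OF \<phi>_q] tendsto_divide[OF tendsto_add[OF \<phi>_q tendsto_const] tendsto_const]]) auto
    then show False using x' by simp
  qed
  moreover have "dist q p \<le> \<phi> p"
    using q_R[of 0] nonneg[OF q(1)] by (simp add: R_def u_def)
  ultimately show ?thesis using q by blast
qed

section \<open>Level sets of almost surjective nonlinear maps\<close>

text \<open>
  A map \<open>H\<close> into \<open>W\<close> whose derivative at \<open>x\<^sub>0\<close> is almost open onto \<open>W\<close> and varies little on the ball
  of radius \<open>\<rho>\<close>. The bound \<open>1 / 16\<close> leaves room for the two errors of \<open>level_descent\<close> below, which
  are doubled there by \<open>correction\<close>.
\<close>

locale almost_submersion =
  fixes H :: "'e::banach \<Rightarrow> 'f::banach" and D :: "'e \<Rightarrow> 'e \<Rightarrow>\<^sub>L 'f" and x\<^sub>0 :: 'e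
    and W :: "'f set" and C \<rho> :: real
  assumes subspace_W: "subspace W" and H_in_W: "H x \<in> W" and D_in_W: "D x v \<in> W"
    and C: "C > 0" and \<rho>: "\<rho> > 0"
    and onto: "w \<in> W \<Longrightarrow> \<exists>e. norm e \<le> C * norm w \<and> norm (w - D x\<^sub>0 e) \<le> norm w / 4"
    and deriv: "x \<in> cball x\<^sub>0 \<rho> \<Longrightarrow> (H has_derivative D x) (at x)"
    and close: "x \<in> cball x\<^sub>0 \<rho> \<Longrightarrow> C * norm (D x - D x\<^sub>0) \<le> 1 / 16"
begin

lemma strict:
  assumes "u \<in> cball x\<^sub>0 \<rho>" "v \<in> cball x\<^sub>0 \<rho>"
  shows "C * norm (H u - H v - D x\<^sub>0 (u - v)) \<le> norm (u - v) / 16"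
proof -
  have "norm ((H u - D x\<^sub>0 u) - (H v - D x\<^sub>0 v)) \<le> 1 / (16 * C) * norm (u - v)"
  proof (rule differentiable_bound[where S = "cball x\<^sub>0 \<rho>" and f' = "\<lambda>x. blinfun_apply (D x - D x\<^sub>0)"])
    show "((\<lambda>x. H x - D x\<^sub>0 x) has_derivative blinfun_apply (D x - D x\<^sub>0)) (at x within cball x\<^sub>0 \<rho>)"
      if "x \<in> cball x\<^sub>0 \<rho>" for x
    proof -
      have "((\<lambda>x. H x - D x\<^sub>0 x) has_derivative (\<lambda>v. D x v - D x\<^sub>0 v)) (at x)"
        by (intro has_derivative_diff deriv that bounded_linear_imp_has_derivative blinfun.bounded_linear_right)
      then show ?thesis by (simp add: blinfun.diff_left[abs_def] has_derivative_at_withinI)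
    qed
    show "onorm (blinfun_apply (D x - D x\<^sub>0)) \<le> 1 / (16 * C)" if "x \<in> cball x\<^sub>0 \<rho>" for x
      using close[OF that] C by (simp add: norm_blinfun.rep_eq[symmetric] field_simps)
  qed (use assms in auto)
  also have "(H u - D x\<^sub>0 u) - (H v - D x\<^sub>0 v) = H u - H v - D x\<^sub>0 (u - v)"
    by (simp add: blinfun.diff_right)
  finally show ?thesis using C by (simp add: field_simps)
qed

lemma correction:
  assumes "y \<in> W" and "norm (x - x\<^sub>0) + 2 * C * norm (y - H x) \<le> \<rho>"
  shows "\<exists>x'. H x' = y \<and> norm (x' - x) \<le> 2 * C * norm (y - H x)"
proof (rule Graves_correction[where W = W and A = "D x\<^sub>0" and S = "cball x\<^sub>0 \<rho>"])
  show "C * norm (H u - H v - D x\<^sub>0 (u - v)) \<le> norm (u - v) / 4"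
    if "u \<in> cball x\<^sub>0 \<rho>" "v \<in> cball x\<^sub>0 \<rho>" for u v
    using strict[OF that] norm_ge_zero[of "u - v"] by linarith
  show "cball x (2 * C * norm (y - H x)) \<subseteq> cball x\<^sub>0 \<rho>"
  proof
    fix z assume "z \<in> cball x (2 * C * norm (y - H x))"
    then have "dist x z \<le> 2 * C * norm (y - H x)" by simp
    then show "z \<in> cball x\<^sub>0 \<rho>"
      using assms(2) dist_triangle[of x\<^sub>0 z x] by (simp add: dist_norm norm_minus_commute)
  qed
qed (use assms subspace_W C onto H_in_W in auto)

text \<open>
  Surjectivity with a uniform constant is stable under small perturbations of the operator:
  solving \<open>D x e = w\<close> is the iteration of \<open>Graves_correction\<close> for the linear map \<open>D x\<close>, with
  \<open>D x\<^sub>0\<close> as the approximating operator.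
\<close>

lemma derivative_onto:
  assumes "x \<in> cball x\<^sub>0 \<rho>" and "w \<in> W"
  shows "\<exists>e. D x e = w \<and> norm e \<le> 2 * C * norm w"
proof -
  have "\<exists>e. D x e = w \<and> norm (e - 0) \<le> 2 * C * norm (w - D x 0)"
  proof (rule Graves_correction[where W = W and A = "D x\<^sub>0" and S = UNIV])
    show "C * norm (D x u - D x v - D x\<^sub>0 (u - v)) \<le> norm (u - v) / 4" for u v
    proof -
      have "D x u - D x v - D x\<^sub>0 (u - v) = (D x - D x\<^sub>0) (u - v)"
        by (simp add: blinfun.diff_left blinfun.diff_right)
      then have "norm (D x u - D x v - D x\<^sub>0 (u - v)) \<le> norm (D x - D x\<^sub>0) * norm (u - v)"
        by (simp only: norm_blinfun)
      then have "C * norm (D x u - D x v - D x\<^sub>0 (u - v)) \<le> (C * norm (D x - D x\<^sub>0)) * norm (u - v)"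
        using C by simp
      also have "\<dots> \<le> (1 / 16) * norm (u - v)"
        by (intro mult_right_mono close assms) auto
      finally show ?thesis using norm_ge_zero[of "u - v"] by linarith
    qed
  qed (use assms subspace_W C onto D_in_W in auto)
  then show ?thesis by (simp add: blinfun.zero_right)
qed

text \<open>
  A functional vanishing on the kernel of \<open>D x\<close> is bounded by a multiple of \<open>norm (D x v)\<close>, by the
  open mapping property. Along the level set \<open>D x (x' - x)\<close> is \<open>o(norm (x' - x))\<close>, so \<open>\<theta>\<close> has zero
  derivative within the level set, whether or not the kernel has a complement.
\<close>

lemma level_increment:
  fixes \<theta> :: "'e \<Rightarrow> real"
  assumes x: "x \<in> cball x\<^sub>0 \<rho>" and \<theta>: "(\<theta> has_derivative T) (at x)"
    and ker: "\<And>v. D x v = 0 \<Longrightarrow> T v = 0" and \<epsilon>: "\<epsilon> > 0"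
  shows "\<exists>\<delta>>0. \<forall>x'. norm (x' - x) < \<delta> \<longrightarrow> H x' = H x \<longrightarrow> \<bar>\<theta> x' - \<theta> x\<bar> \<le> \<epsilon> * norm (x' - x)"
proof -
  interpret T: bounded_linear T using \<theta> by (rule has_derivative_bounded_linear)
  obtain K where K: "K > 0" "\<And>v. norm (T v) \<le> norm v * K"
    using T.pos_bounded by blast
  define M where "M = 2 * C * K"
  have M: "M > 0" using K C by (simp add: M_def)
  \<comment> \<open>Replace \<open>v\<close> by the short vector \<open>e\<close> with the same image, which differs from it by a kernel element.\<close>
  have T_bound: "\<bar>T v\<bar> \<le> M * norm (D x v)" for v
  proof -
    obtain e where e: "D x e = D x v" "norm e \<le> 2 * C * norm (D x v)"
      using derivative_onto[OF x D_in_W, of x v] by blast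
    then have "T (v - e) = 0" by (intro ker) (simp add: blinfun.diff_right)
    then have "T v = T e" by (simp add: T.diff)
    then have "\<bar>T v\<bar> \<le> norm e * K" using K(2)[of e] by simp
    also have "\<dots> \<le> (2 * C * norm (D x v)) * K" using e K by (intro mult_right_mono) auto
    finally show ?thesis by (simp add: M_def algebra_simps)
  qed
  have "\<epsilon> / (2 * M) > 0" "\<epsilon> / 2 > 0" using \<epsilon> M by auto
  then obtain \<delta>1 \<delta>2 where \<delta>: "\<delta>1 > 0" "\<delta>2 > 0"
    "\<And>x'. norm (x' - x) < \<delta>1 \<Longrightarrow> norm (H x' - H x - D x (x' - x)) \<le> \<epsilon> / (2 * M) * norm (x' - x)"
    "\<And>x'. norm (x' - x) < \<delta>2 \<Longrightarrow> norm (\<theta> x' - \<theta> x - T (x' - x)) \<le> \<epsilon> / 2 * norm (x' - x)"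
    using deriv[OF x] \<theta> unfolding has_derivative_at_alt by metis
  show ?thesis
  proof (intro exI[of _ "min \<delta>1 \<delta>2"] conjI allI impI)
    fix x' assume near: "norm (x' - x) < min \<delta>1 \<delta>2" and level: "H x' = H x"
    have "M * norm (D x (x' - x)) \<le> M * (\<epsilon> / (2 * M) * norm (x' - x))"
      using \<delta>(3)[of x'] near level M by (intro mult_left_mono) auto
    also have "\<dots> = \<epsilon> / 2 * norm (x' - x)" using M by simp
    finally have "\<bar>T (x' - x)\<bar> \<le> \<epsilon> * norm (x' - x) / 2" using T_bound[of "x' - x"] by simp
    moreover have "\<bar>\<theta> x' - \<theta> x - T (x' - x)\<bar> \<le> \<epsilon> * norm (x' - x) / 2"
      using \<delta>(4)[of x'] near by simp
    ultimately show "\<bar>\<theta> x' - \<theta> x\<bar> \<le> \<epsilon> * norm (x' - x)"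
      by argo
  qed (use \<delta> in auto)
qed

text \<open>
  From a point \<open>x\<close> of the level set of \<open>x\<^sub>0\<close> one can jump, within the level set, towards \<open>x\<^sub>0\<close>: go the
  fraction \<open>h\<close> of the way along the segment and correct the value of \<open>H\<close>. Since \<open>H x = H x\<^sub>0\<close>, the
  direction \<open>x\<^sub>0 - x\<close> almost lies in the kernel of \<open>D x\<^sub>0\<close>, and the correction costs only a quarter
  of the progress.
\<close>

lemma level_descent:
  assumes x: "x \<in> cball x\<^sub>0 \<rho>" "H x = H x\<^sub>0" "x \<noteq> x\<^sub>0" and \<delta>: "\<delta> > 0"
  shows "\<exists>x'. H x' = H x\<^sub>0 \<and> norm (x' - x\<^sub>0) < norm (x - x\<^sub>0) \<and> norm (x' - x) < \<delta> \<and>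
    norm (x' - x) \<le> 4 * (norm (x - x\<^sub>0) - norm (x' - x\<^sub>0))"
proof -
  define n where "n = norm (x - x\<^sub>0)"
  have n: "n > 0" "n \<le> \<rho>" using x by (auto simp: n_def dist_norm norm_minus_commute)
  define h where "h = min (1 / 2) (\<delta> / (4 * n))"
  have h: "0 < h" "h \<le> 1 / 2" "h * n \<le> \<delta> / 4"
    using n \<delta> by (auto simp: h_def min_def field_simps)
  define z where "z = x + h *\<^sub>R (x\<^sub>0 - x)"
  have z_x0: "norm (z - x\<^sub>0) = (1 - h) * n"
  proof -
    have "z - x\<^sub>0 = (1 - h) *\<^sub>R (x - x\<^sub>0)" by (simp add: z_def algebra_simps)
    then show ?thesis using h by (simp add: n_def)
  qed
  have z_x: "norm (z - x) = h * n"
    using h by (simp add: z_def n_def norm_minus_commute)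
  have "(1 - h) * n \<le> n" using h n by simp
  then have "norm (z - x\<^sub>0) \<le> \<rho>" using z_x0 n by linarith
  then have z: "z \<in> cball x\<^sub>0 \<rho>" by (simp add: dist_norm norm_minus_commute)
  have "C * norm (D x\<^sub>0 (x\<^sub>0 - x)) \<le> n / 16"
    using strict[of x\<^sub>0 x] x \<rho> by (simp add: n_def norm_minus_commute)
  then have "h * (C * norm (D x\<^sub>0 (x\<^sub>0 - x))) \<le> h * (n / 16)" using h by (intro mult_left_mono) auto
  then have 1: "C * norm (D x\<^sub>0 (z - x)) \<le> h * n / 16"
    using h by (simp add: z_def blinfun.scaleR_right mult.left_commute)
  have 2: "C * norm (H z - H x - D x\<^sub>0 (z - x)) \<le> h * n / 16"
    using strict[OF z x(1)] z_x by simp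
  have "norm (H x\<^sub>0 - H z) \<le> norm (H z - H x - D x\<^sub>0 (z - x)) + norm (D x\<^sub>0 (z - x))"
    using norm_triangle_ineq[of "H z - H x - D x\<^sub>0 (z - x)" "D x\<^sub>0 (z - x)"] x(2)
    by (simp add: norm_minus_commute)
  then have "C * norm (H x\<^sub>0 - H z) \<le> C * (norm (H z - H x - D x\<^sub>0 (z - x)) + norm (D x\<^sub>0 (z - x)))"
    using C by (intro mult_left_mono) auto
  then have res: "2 * C * norm (H x\<^sub>0 - H z) \<le> h * n / 4"
    using 1 2 by (simp add: distrib_left)
  have hn: "h * n > 0" using h n by simp
  have "norm (z - x\<^sub>0) + 2 * C * norm (H x\<^sub>0 - H z) \<le> \<rho>"
    using res z_x0 n hn by (simp add: algebra_simps)
  from correction[OF H_in_W this] obtain x' where x': "H x' = H x\<^sub>0" "norm (x' - z) \<le> h * n / 4"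
    using res by (meson order_trans)
  have "norm (x' - x\<^sub>0) \<le> norm (x' - z) + norm (z - x\<^sub>0)"
    by (metis norm_triangle_ineq diff_add_cancel add_diff_eq)
  then have a: "norm (x' - x\<^sub>0) \<le> n - 3 / 4 * (h * n)"
    using x' z_x0 by (simp add: algebra_simps)
  have "norm (x' - x) \<le> norm (x' - z) + norm (z - x)"
    by (metis norm_triangle_ineq diff_add_cancel add_diff_eq)
  then have b: "norm (x' - x) \<le> 5 / 4 * (h * n)"
    using x' z_x by simp
  show ?thesis
  proof (intro exI[of _ x'] conjI x'(1))
    show "norm (x' - x\<^sub>0) < norm (x - x\<^sub>0)" using a hn by (simp add: n_def)
    show "norm (x' - x) < \<delta>" using b h(3) \<delta> by linarith
    show "norm (x' - x) \<le> 4 * (norm (x - x\<^sub>0) - norm (x' - x\<^sub>0))"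
    proof -
      have "norm (x' - x) \<le> 4 * (n - norm (x' - x\<^sub>0))"
        using a b hn by argo
      then show ?thesis by (simp add: n_def)
    qed
  qed
qed

text \<open>
  The jumps of \<open>level_descent\<close>, taken so short that \<open>level_increment\<close> applies with \<open>\<epsilon>\<close>, lead from \<open>p\<close>
  to \<open>x\<^sub>0\<close> with total length at most a fixed multiple of \<open>norm (p - x\<^sub>0)\<close>. Hence the values of \<open>\<theta>\<close> at
  the two ends differ by at most a multiple of \<open>\<epsilon>\<close>, for every \<open>\<epsilon>\<close>.
\<close>

lemma constant_on_level:
  fixes \<theta> :: "'e \<Rightarrow> real"
  assumes p: "p \<in> cball x\<^sub>0 \<rho>" "H p = H x\<^sub>0"
    and \<theta>: "\<And>x. x \<in> cball x\<^sub>0 \<rho> \<Longrightarrow> (\<theta> has_derivative T x) (at x)"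
    and ker: "\<And>x v. x \<in> cball x\<^sub>0 \<rho> \<Longrightarrow> D x v = 0 \<Longrightarrow> T x v = 0"
  shows "\<theta> p = \<theta> x\<^sub>0"
proof -
  define S where "S = {x \<in> cball x\<^sub>0 \<rho>. H x = H x\<^sub>0}"
  have S_cont: "continuous_on S \<theta>"
    by (intro continuous_at_imp_continuous_on ballI, rule has_derivative_continuous[OF \<theta>]) (simp add: S_def)
  have "continuous_on (cball x\<^sub>0 \<rho>) H"
    by (intro continuous_at_imp_continuous_on ballI) (rule has_derivative_continuous[OF deriv])
  then have S_closed: "closed S"
    unfolding S_def by (intro continuous_closed_preimage_constant closed_cball)
  have bound: "\<bar>\<theta> p - \<theta> x\<^sub>0\<bar> \<le> \<epsilon> * (8 * norm (p - x\<^sub>0))" if \<epsilon>: "\<epsilon> > 0" for \<epsilon>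
  proof -
    \<comment> \<open>Descent on the graph of \<open>\<theta> / \<epsilon>\<close> controls the jump in the space and the change of \<open>\<theta>\<close> at once;
      each is at most 4 times the gain in distance to \<open>x\<^sub>0\<close>, whence the factor 8.\<close>
    define S' where "S' = (\<lambda>x. (x, \<theta> x / \<epsilon>)) ` S"
    define \<phi> :: "'e \<times> real \<Rightarrow> real" where "\<phi> z = 8 * norm (fst z - x\<^sub>0)" for z
    have "\<exists>q\<in>S'. \<phi> q = 0 \<and> dist q (p, \<theta> p / \<epsilon>) \<le> \<phi> (p, \<theta> p / \<epsilon>)"
    proof (rule Caristi_descent)
      have "closed S'"
      proof -
        have "S' = {z \<in> S \<times> UNIV. \<theta> (fst z) / \<epsilon> - snd z = 0}"
          by (auto simp: S'_def)
        moreover have "continuous_on (S \<times> UNIV) (\<lambda>z. \<theta> (fst z) / \<epsilon> - snd z)"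
          using \<epsilon> by (intro continuous_intros continuous_on_compose2[OF S_cont]) auto
        ultimately show ?thesis
          using S_closed by (simp only: continuous_closed_preimage_constant closed_Times closed_UNIV)
      qed
      then show "complete S'" by (simp add: complete_eq_closed)
      show "continuous_on S' \<phi>" unfolding \<phi>_def by (intro continuous_intros)
      show "0 \<le> \<phi> z" for z by (simp add: \<phi>_def)
      show "(p, \<theta> p / \<epsilon>) \<in> S'" using p unfolding S'_def S_def by (intro imageI) simp
      fix z assume z: "z \<in> S'" "0 < \<phi> z"
      then obtain x where x: "x \<in> S" "z = (x, \<theta> x / \<epsilon>)" by (auto simp: S'_def)
      have x_ball: "x \<in> cball x\<^sub>0 \<rho>" and x_level: "H x = H x\<^sub>0" and "x \<noteq> x\<^sub>0"
        using x z by (auto simp: S_def \<phi>_def)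
      obtain \<delta> where \<delta>: "\<delta> > 0"
        "\<And>x'. norm (x' - x) < \<delta> \<Longrightarrow> H x' = H x \<Longrightarrow> \<bar>\<theta> x' - \<theta> x\<bar> \<le> \<epsilon> * norm (x' - x)"
        using level_increment[OF x_ball \<theta>[OF x_ball] ker[OF x_ball] \<epsilon>] by blast
      obtain x' where x': "H x' = H x\<^sub>0" "norm (x' - x\<^sub>0) < norm (x - x\<^sub>0)" "norm (x' - x) < \<delta>"
        "norm (x' - x) \<le> 4 * (norm (x - x\<^sub>0) - norm (x' - x\<^sub>0))"
        using level_descent[OF x_ball x_level \<open>x \<noteq> x\<^sub>0\<close> \<delta>(1)] by blast
      have "\<bar>\<theta> x' - \<theta> x\<bar> \<le> \<epsilon> * norm (x' - x)" using \<delta>(2)[of x'] x' x_level by simp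
      then have "\<bar>\<theta> x' / \<epsilon> - \<theta> x / \<epsilon>\<bar> \<le> norm (x' - x)"
        using \<epsilon> by (simp add: diff_divide_distrib[symmetric] field_simps)
      moreover have "dist (x', \<theta> x' / \<epsilon>) z \<le> norm (x' - x) + \<bar>\<theta> x' / \<epsilon> - \<theta> x / \<epsilon>\<bar>"
        using norm_Pair_le[of "x' - x" "\<theta> x' / \<epsilon> - \<theta> x / \<epsilon>"] by (simp add: x(2) dist_norm)
      ultimately have "dist (x', \<theta> x' / \<epsilon>) z \<le> \<phi> z - \<phi> (x', \<theta> x' / \<epsilon>)"
        using x'(4) by (simp add: \<phi>_def x(2))
      moreover have "(x', \<theta> x' / \<epsilon>) \<in> S'"
        using x' x_ball by (auto simp: S'_def S_def dist_norm norm_minus_commute)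
      moreover have "\<phi> (x', \<theta> x' / \<epsilon>) < \<phi> z" using x' by (simp add: \<phi>_def x(2))
      ultimately show "\<exists>z'\<in>S'. \<phi> z' < \<phi> z \<and> dist z' z \<le> \<phi> z - \<phi> z'" by blast
    qed
    then obtain q where "q \<in> S'" "\<phi> q = 0" "dist q (p, \<theta> p / \<epsilon>) \<le> 8 * norm (p - x\<^sub>0)"
      by (auto simp: \<phi>_def)
    then have "dist (x\<^sub>0, \<theta> x\<^sub>0 / \<epsilon>) (p, \<theta> p / \<epsilon>) \<le> 8 * norm (p - x\<^sub>0)"
      by (auto simp: S'_def \<phi>_def)
    then have "\<bar>\<theta> x\<^sub>0 / \<epsilon> - \<theta> p / \<epsilon>\<bar> \<le> 8 * norm (p - x\<^sub>0)"
      using dist_snd_le[of "(x\<^sub>0, \<theta> x\<^sub>0 / \<epsilon>)" "(p, \<theta> p / \<epsilon>)"] by (simp add: dist_real_def)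
    then show ?thesis using \<epsilon> by (simp add: diff_divide_distrib[symmetric] field_simps abs_minus_commute)
  qed
  have "\<bar>\<theta> p - \<theta> x\<^sub>0\<bar> \<le> 0"
  proof (rule field_le_epsilon)
    fix e :: real assume e: "e > 0"
    let ?K = "8 * norm (p - x\<^sub>0) + 1"
    have K: "?K > 0" by (simp add: add_nonneg_pos)
    have "\<bar>\<theta> p - \<theta> x\<^sub>0\<bar> \<le> (e / ?K) * (8 * norm (p - x\<^sub>0))"
      using e K by (intro bound) auto
    also have "\<dots> \<le> (e / ?K) * ?K" using e K by (intro mult_left_mono) auto
    also have "\<dots> = e" using K by simp
    finally show "\<bar>\<theta> p - \<theta> x\<^sub>0\<bar> \<le> 0 + e" by simp
  qed
  then show ?thesis by simp
qed

text \<open>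
  The residual of \<open>H\<close> at \<open>x\<^sub>0 + t d\<close> is \<open>o(t)\<close> because \<open>d\<close> is in the kernel, and the correction that
  removes it has comparable size.
\<close>

lemma Ljusternik_curve:
  assumes d: "D x\<^sub>0 d = 0"
  shows "\<exists>r. ((\<lambda>t. norm (r t) / t) \<longlongrightarrow> 0) (at_right 0) \<and>
    (\<forall>\<^sub>F t in at_right 0. x\<^sub>0 + t *\<^sub>R d + r t \<in> cball x\<^sub>0 \<rho> \<and> H (x\<^sub>0 + t *\<^sub>R d + r t) = H x\<^sub>0)"
proof -
  define e where "e t = 2 * C * norm (H x\<^sub>0 - H (x\<^sub>0 + t *\<^sub>R d))" for t
  have e_nonneg: "e t \<ge> 0" for t using C by (simp add: e_def)
  have e_small: "((\<lambda>t. e t / t) \<longlongrightarrow> 0) (at_right 0)"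
  proof -
    have "((\<lambda>t. H (x\<^sub>0 + t *\<^sub>R d)) has_derivative (\<lambda>t. D x\<^sub>0 (t *\<^sub>R d))) (at 0)"
    proof (rule has_derivative_compose[where f = "\<lambda>t. x\<^sub>0 + t *\<^sub>R d"])
      show "((\<lambda>t. x\<^sub>0 + t *\<^sub>R d) has_derivative (\<lambda>t. t *\<^sub>R d)) (at 0)"
        by (auto intro!: derivative_eq_intros)
      show "(H has_derivative D x\<^sub>0) (at (x\<^sub>0 + 0 *\<^sub>R d))"
        using deriv[of x\<^sub>0] \<rho> by simp
    qed
    then have "((\<lambda>t. norm (H (x\<^sub>0 + t *\<^sub>R d) - H x\<^sub>0) / norm t) \<longlongrightarrow> 0) (at 0)"
      by (simp add: has_derivative_iff_norm d blinfun.scaleR_right)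
    then have "((\<lambda>t. 2 * C * (norm (H (x\<^sub>0 + t *\<^sub>R d) - H x\<^sub>0) / norm t)) \<longlongrightarrow> 0) (at_right 0)"
      by (intro tendsto_mult_right_zero) (rule filterlim_mono[OF _ order_refl at_le], auto)
    moreover have "\<forall>\<^sub>F t in at_right 0. 2 * C * (norm (H (x\<^sub>0 + t *\<^sub>R d) - H x\<^sub>0) / norm t) = e t / t"
      by (auto simp: eventually_at_filter e_def norm_minus_commute)
    ultimately show ?thesis by (rule Lim_transform_eventually)
  qed
  define good where "good t s \<longleftrightarrow> H (x\<^sub>0 + t *\<^sub>R d + s) = H x\<^sub>0 \<and> norm s \<le> e t" for t s
  \<comment> \<open>The default value 0 keeps the bound by \<open>e\<close> for all \<open>t\<close>, also where no correction exists.\<close>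
  define r where "r t = (if \<exists>s. good t s then SOME s. good t s else 0)" for t
  have r_le: "norm (r t) \<le> e t" for t
  proof (cases "\<exists>s. good t s")
    case True
    then have "good t (r t)" unfolding r_def by (simp add: someI_ex)
    then show ?thesis by (simp add: good_def)
  next
    case False
    then show ?thesis using e_nonneg by (simp add: r_def)
  qed
  have r_small: "((\<lambda>t. norm (r t) / t) \<longlongrightarrow> 0) (at_right 0)"
  proof (rule tendsto_sandwich[OF _ _ tendsto_const e_small])
    show "\<forall>\<^sub>F t in at_right 0. 0 \<le> norm (r t) / t"
      by (auto simp: eventually_at_filter)
    show "\<forall>\<^sub>F t in at_right 0. norm (r t) / t \<le> e t / t"
      using r_le by (intro eventually_mono[OF eventually_at_right_less[of 0]] divide_right_mono) auto
  qed
  have "((\<lambda>t. norm (t *\<^sub>R d) + e t / t * t) \<longlongrightarrow> norm (0 *\<^sub>R d) + 0 * 0) (at_right 0)"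
    by (intro tendsto_intros e_small)
  then have "\<forall>\<^sub>F t in at_right 0. norm (t *\<^sub>R d) + e t / t * t < \<rho>"
    using \<rho> by (intro order_tendstoD(2)) auto
  moreover have "\<forall>\<^sub>F t in at_right (0::real). t > 0" by (simp add: eventually_at_right_less)
  ultimately have "\<forall>\<^sub>F t in at_right 0. x\<^sub>0 + t *\<^sub>R d + r t \<in> cball x\<^sub>0 \<rho> \<and> H (x\<^sub>0 + t *\<^sub>R d + r t) = H x\<^sub>0"
  proof eventually_elim
    case (elim t)
    then have small: "norm (t *\<^sub>R d) + e t \<le> \<rho>" by simp
    have "\<exists>x'. H x' = H x\<^sub>0 \<and> norm (x' - (x\<^sub>0 + t *\<^sub>R d)) \<le> e t"
      using correction[OF H_in_W, of "x\<^sub>0 + t *\<^sub>R d" x\<^sub>0] small by (simp add: e_def)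
    then obtain x' where "H x' = H x\<^sub>0" "norm (x' - (x\<^sub>0 + t *\<^sub>R d)) \<le> e t" by blast
    then have "good t (x' - (x\<^sub>0 + t *\<^sub>R d))" by (simp add: good_def)
    then have "good t (r t)" unfolding r_def by (metis someI_ex)
    moreover have "norm (t *\<^sub>R d + r t) \<le> \<rho>"
      using norm_triangle_ineq[of "t *\<^sub>R d" "r t"] r_le[of t] small by linarith
    moreover have "dist x\<^sub>0 (x\<^sub>0 + t *\<^sub>R d + r t) = norm (t *\<^sub>R d + r t)"
      by (metis add.assoc add_diff_cancel_left' dist_commute dist_norm)
    ultimately show ?case by (simp add: good_def)
  qed
  then show ?thesis using r_small by blast
qed

end

section \<open>Separation in Hilbert space and in the weak* topology\<close>

text \<open>
  By the parallelogram law, a minimizing sequence in a convex set is a Cauchy sequence; thus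
  completeness replaces compactness of bounded sets.
\<close>

lemma nearest_point_exists:
  fixes S :: "'a::{real_inner, banach} set"
  assumes "closed S" "convex S" "S \<noteq> {}"
  shows "\<exists>p\<in>S. \<forall>s\<in>S. norm (h - p) \<le> norm (h - s)"
proof -
  define m where "m = (INF s\<in>S. (norm (h - s))\<^sup>2)"
  have bdd: "bdd_below ((\<lambda>s. (norm (h - s))\<^sup>2) ` S)"
    by (intro bdd_belowI[of _ 0]) auto
  have m_le: "m \<le> (norm (h - s))\<^sup>2" if "s \<in> S" for s
    unfolding m_def using bdd that by (rule cINF_lower)
  have "\<exists>s\<in>S. (norm (h - s))\<^sup>2 < m + inverse (real (Suc n))" for n
    unfolding m_def using cINF_less_iff[OF assms(3) bdd, of "m + inverse (real (Suc n))"]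
    by (simp add: m_def del: of_nat_Suc)
  then obtain s where s: "\<And>n. s n \<in> S" "\<And>n. (norm (h - s n))\<^sup>2 < m + inverse (real (Suc n))"
    by metis
  have parallelogram: "(norm (s i - s j))\<^sup>2 \<le> 2 * inverse (real (Suc i)) + 2 * inverse (real (Suc j))" for i j
  proof -
    have "(1/2) *\<^sub>R s i + (1/2) *\<^sub>R s j \<in> S" using assms s by (intro convexD) auto
    then have "m \<le> (norm (h - ((1/2) *\<^sub>R s i + (1/2) *\<^sub>R s j)))\<^sup>2" by (rule m_le)
    moreover have "(norm (s i - s j))\<^sup>2 = 2 * (norm (h - s i))\<^sup>2 + 2 * (norm (h - s j))\<^sup>2
        - 4 * (norm (h - ((1/2) *\<^sub>R s i + (1/2) *\<^sub>R s j)))\<^sup>2"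
    proof -
      define a c where "a = h - s i" and "c = h - s j"
      have "h = (1/2) *\<^sub>R h + (1/2) *\<^sub>R h" by (simp flip: scaleR_add_left)
      then have "h - ((1/2) *\<^sub>R s i + (1/2) *\<^sub>R s j) = (1/2) *\<^sub>R (a + c)"
        unfolding a_def c_def scaleR_add_right scaleR_diff_right by (metis add_diff_add)
      then have "4 * (norm (h - ((1/2) *\<^sub>R s i + (1/2) *\<^sub>R s j)))\<^sup>2 = (norm (a + c))\<^sup>2"
        by (simp add: power_divide)
      moreover have "s i - s j = c - a" by (simp add: a_def c_def)
      moreover have "(norm (c - a))\<^sup>2 = 2 * (norm a)\<^sup>2 + 2 * (norm c)\<^sup>2 - (norm (a + c))\<^sup>2"
        by (simp add: power2_norm_eq_inner inner_diff_left inner_diff_right inner_add_left inner_add_right inner_commute)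
      ultimately show ?thesis by (simp add: a_def c_def)
    qed
    ultimately show ?thesis using s(2)[of i] s(2)[of j] by linarith
  qed
  have "Cauchy s"
  proof (rule metric_CauchyI)
    fix e :: real assume e: "e > 0"
    obtain M where M: "inverse (real (Suc M)) < e\<^sup>2 / 4"
      using reals_Archimedean[of "e\<^sup>2 / 4"] e by auto
    have "dist (s i) (s j) < e" if ij: "i \<ge> M" "j \<ge> M" for i j
    proof -
      have inv: "inverse (real (Suc k)) \<le> inverse (real (Suc M))" if "k \<ge> M" for k
        using that by (intro le_imp_inverse_le) auto
      have "(norm (s i - s j))\<^sup>2 < e\<^sup>2"
        using parallelogram[of i j] M inv[OF ij(1)] inv[OF ij(2)] by linarith
      then show ?thesis using e by (simp add: dist_norm power2_less_imp_less)
    qed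
    then show "\<exists>M. \<forall>m\<ge>M. \<forall>n\<ge>M. dist (s m) (s n) < e" by blast
  qed
  then obtain p where p: "s \<longlonglongrightarrow> p" using Cauchy_convergent_iff convergent_def by blast
  have "p \<in> S" using assms(1) s(1) p by (rule closed_sequentially)
  have pm: "(norm (h - p))\<^sup>2 \<le> m"
  proof (rule LIMSEQ_le)
    show "(\<lambda>n. (norm (h - s n))\<^sup>2) \<longlonglongrightarrow> (norm (h - p))\<^sup>2" by (intro tendsto_intros p)
    show "(\<lambda>n. m + inverse (real (Suc n))) \<longlonglongrightarrow> m"
      using LIMSEQ_inverse_real_of_nat_add by simp
    show "\<exists>N. \<forall>n\<ge>N. (norm (h - s n))\<^sup>2 \<le> m + inverse (real (Suc n))"
      using s(2) less_imp_le by blast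
  qed
  have "norm (h - p) \<le> norm (h - s)" if "s \<in> S" for s
    by (rule power2_le_imp_le[OF order_trans[OF pm m_le[OF that]] norm_ge_zero])
  then show ?thesis using \<open>p \<in> S\<close> by blast
qed

lemma closed_convex_separation:
  fixes S :: "'a::{real_inner, banach} set"
  assumes S: "closed S" "convex S" "S \<noteq> {}" and h: "h \<notin> S"
  obtains l c where "\<And>s. s \<in> S \<Longrightarrow> l \<bullet> s \<le> c" "c < l \<bullet> h"
proof -
  obtain p where p: "p \<in> S" "\<And>s. s \<in> S \<Longrightarrow> norm (h - p) \<le> norm (h - s)"
    using nearest_point_exists[OF S, of h] by blast
  have "(h - p) \<bullet> (s - p) \<le> 0" if "s \<in> S" for s
    using S(2,1) p(1) that by (rule any_closest_point_dot) (simp add: dist_norm p(2))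
  moreover have "(h - p) \<bullet> (h - p) > 0" using h p by auto
  ultimately show thesis
    by (intro that[of "h - p" "(h - p) \<bullet> p"]) (auto simp: inner_diff_right)
qed

lemma closed_convex_cone_separation:
  fixes S :: "'a::{real_inner, banach} set"
  assumes S: "closed S" "convex S" "cone S" "S \<noteq> {}" and h: "h \<notin> S"
  obtains l where "\<And>s. s \<in> S \<Longrightarrow> l \<bullet> s \<le> 0" "l \<bullet> h > 0"
proof -
  obtain l c where l: "\<And>s. s \<in> S \<Longrightarrow> l \<bullet> s \<le> c" "c < l \<bullet> h"
    using closed_convex_separation[OF S(1,2,4) h] by blast
  have "0 \<in> S" using S(3,4) cone_contains_0 by blast
  then have c: "c \<ge> 0" using l(1)[of 0] by simp
  have "l \<bullet> s \<le> 0" if s: "s \<in> S" for s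
  proof (rule ccontr)
    assume "\<not> ?thesis"
    then have pos: "l \<bullet> s > 0" by simp
    have "((c + 1) / (l \<bullet> s)) *\<^sub>R s \<in> S" using S(3) s pos c by (simp add: cone_def)
    from l(1)[OF this] show False using pos by simp
  qed
  then show thesis using l c by (intro that[of l]) auto
qed

text \<open>
  The dual form of surjectivity: if \<open>w\<close> were not in the closed image of the ball of radius
  \<open>C * norm w\<close>, a separating \<open>l\<close> would have \<open>C * norm w * norm (adj A l) < l \<bullet> w\<close>.
\<close>

lemma almost_open_if_adjoint_bounded_below:
  fixes A :: "'e::real_normed_vector \<Rightarrow>\<^sub>L 'f::{real_inner, banach}"
  assumes C: "C > 0" and below: "\<And>l. l \<bullet> w \<le> C * norm w * norm (adj A l)"
  shows "\<exists>e. norm e \<le> C * norm w \<and> norm (w - A e) \<le> norm w / 4"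
proof (cases "w = 0")
  case True
  then show ?thesis by (intro exI[of _ 0]) (simp add: blinfun.zero_right)
next
  case False
  define R where "R = C * norm w"
  have R: "R > 0" using C False by (simp add: R_def)
  let ?B = "closure (blinfun_apply A ` cball 0 R)"
  have "w \<in> ?B"
  proof (rule ccontr)
    assume "w \<notin> ?B"
    moreover have "convex ?B"
      by (intro convex_closure convex_linear_image bounded_linear.linear blinfun.bounded_linear_right convex_cball)
    moreover have "?B \<noteq> {}" using R by simp
    ultimately obtain l c where l: "\<And>s. s \<in> ?B \<Longrightarrow> l \<bullet> s \<le> c" "c < l \<bullet> w"
      using closed_convex_separation[of ?B w] closed_closure by blast
    have le: "l \<bullet> A e \<le> c" if "norm e \<le> R" for e
      using that by (intro l(1) subsetD[OF closure_subset] imageI) simp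
    have c: "c \<ge> 0" using le[of 0] R by (simp add: blinfun.zero_right)
    have "norm (adj A l) \<le> c / R"
    proof (rule norm_blinfun_bound)
      show "0 \<le> c / R" using c R by simp
      fix e
      show "norm (adj A l e) \<le> c / R * norm e"
      proof (cases "e = 0")
        case False
        have "l \<bullet> A ((R / norm e) *\<^sub>R e) \<le> c" "l \<bullet> A ((- R / norm e) *\<^sub>R e) \<le> c"
          using R False by (auto intro!: le)
        then show ?thesis
          using R False by (simp add: adj_def blinfun.scaleR_right blinfun.minus_right field_simps abs_le_iff)
      qed (simp add: blinfun.zero_right)
    qed
    then have "R * norm (adj A l) \<le> c" using R by (simp add: field_simps)
    then show False using below[of l] l(2) by (simp add: R_def)
  qed
  then obtain e where "norm e \<le> R" "dist (A e) w < norm w / 4"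
    using False unfolding closure_approachable by (force dest!: spec[of _ "norm w / 4"])
  then show ?thesis
    by (intro exI[of _ e]) (simp add: R_def dist_norm norm_minus_commute)
qed

text \<open>
  A weak* neighbourhood involves only finitely many evaluations at points \<open>e\<^sub>0, \<dots>, e\<^sub>n\<^sub>-\<^sub>1\<close>, so the
  separation takes place in a space of dimension \<open>n\<close>. The biorthogonal system \<open>b\<close>, \<open>bs\<close> serves to
  embed these spaces, for all \<open>n\<close>, into one Hilbert space; the separating vector pulls back to a
  linear combination of the \<open>e\<^sub>i\<close>, that is, to a point of the predual.
\<close>

lemma weak_star_separation:
  fixes S :: "('e::real_normed_vector \<Rightarrow>\<^sub>L real) set" and b :: "nat \<Rightarrow> 'h::{real_inner, banach}"
    and bs :: "nat \<Rightarrow> 'h \<Rightarrow>\<^sub>L real"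
  assumes S: "closedin weak_star_topology S" "convex S" "cone S" "S \<noteq> {}" and \<phi>: "\<phi> \<notin> S"
    and biorth: "\<And>i j. blinfun_apply (bs i) (b j) = (if i = j then 1 else 0)"
  shows "\<exists>e. (\<forall>\<psi>\<in>S. blinfun_apply \<psi> e \<le> 0) \<and> blinfun_apply \<phi> e > 0"
proof -
  have "openin weak_star_topology (- S)"
    using S(1) by (simp add: closedin_def strong_operator_topology_topspace Compl_eq_Diff_UNIV)
  then obtain O' where O': "open O'" "- S = blinfun_apply -` O'"
    by (auto simp: strong_operator_topology_def openin_pullback_topology)
  have "blinfun_apply \<phi> \<in> O'" using O' \<phi> by blast
  moreover have "openin (product_topology (\<lambda>_. euclidean) UNIV) O'" using O'(1) by (simp add: open_fun_def)
  ultimately obtain U where U: "finite {e. U e \<noteq> UNIV}" "\<And>e. open (U e)"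
      "\<And>e. \<phi> e \<in> U e" "Pi\<^sub>E UNIV U \<subseteq> O'"
    unfolding openin_product_topology_alt by (force simp: PiE_iff)
  obtain n and e :: "nat \<Rightarrow> 'e" where e: "{e. U e \<noteq> UNIV} = e ` {..<n}"
    using finite_imp_nat_seg_image_inj_on[OF U(1)] by (auto simp: lessThan_def)
  have off: "\<exists>i<n. \<psi> (e i) \<notin> U (e i)" if "\<psi> \<in> S" for \<psi> :: "'e \<Rightarrow>\<^sub>L real"
  proof (rule ccontr)
    assume "\<not> ?thesis"
    then have "\<psi> x \<in> U x" for x
      using e by (cases "x \<in> e ` {..<n}") auto
    then have "blinfun_apply \<psi> \<in> O'" using U(4) by (auto simp: PiE_iff subset_iff)
    then show False using O' that by blast
  qed
  define \<Phi> where "\<Phi> \<psi> = (\<Sum>i<n. blinfun_apply \<psi> (e i) *\<^sub>R b i)" for \<psi> :: "'e \<Rightarrow>\<^sub>L real"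
  have lin: "linear \<Phi>"
    by (rule linearI)
      (simp_all add: \<Phi>_def blinfun.add_left blinfun.scaleR_left scaleR_add_left sum.distrib scaleR_sum_right)
  have coord: "bs i (\<Phi> \<psi>) = \<psi> (e i)" if "i < n" for i \<psi>
  proof -
    have "bs i (\<Phi> \<psi>) = (\<Sum>j<n. \<psi> (e j) * (if i = j then 1 else 0))"
      by (simp add: \<Phi>_def blinfun.sum_right blinfun.scaleR_right biorth)
    also have "\<dots> = \<psi> (e i)" using that by (simp add: if_distrib sum.delta' cong: if_cong)
    finally show ?thesis .
  qed
  \<comment> \<open>The neighbourhood of \<open>\<phi>\<close> is the preimage of an open set under the finitely many coordinates.\<close>
  have "\<Phi> \<phi> \<notin> closure (\<Phi> ` S)"
  proof -
    define N where "N = (\<Inter>i\<in>{..<n}. blinfun_apply (bs i) -` U (e i))"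
    have "open N" unfolding N_def
      by (intro open_INT ballI continuous_open_vimage U(2) finite_lessThan) (simp add: linear_continuous_at blinfun.bounded_linear_right)
    moreover have "\<Phi> \<phi> \<in> N" using U(3) by (simp add: N_def coord)
    moreover have "N \<inter> \<Phi> ` S = {}" using off coord by (fastforce simp: N_def)
    ultimately show ?thesis using open_Int_closure_eq_empty[of N "\<Phi> ` S"] by blast
  qed
  moreover have "cone (closure (\<Phi> ` S))"
    using S(3) lin by (intro cone_closure) (auto simp: cone_def linear_cmul[symmetric] intro!: imageI)
  moreover have "convex (closure (\<Phi> ` S))"
    using S(2) lin by (intro convex_closure convex_linear_image)
  moreover have "closure (\<Phi> ` S) \<noteq> {}" using S(4) by simp
  ultimately obtain l where l: "\<And>s. s \<in> closure (\<Phi> ` S) \<Longrightarrow> l \<bullet> s \<le> 0" "l \<bullet> \<Phi> \<phi> > 0"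
    using closed_convex_cone_separation[OF closed_closure, of "\<Phi> ` S" "\<Phi> \<phi>"] by metis
  define d where "d = (\<Sum>i<n. (l \<bullet> b i) *\<^sub>R e i)"
  have d: "\<psi> d = l \<bullet> \<Phi> \<psi>" for \<psi> :: "'e \<Rightarrow>\<^sub>L real"
    by (simp add: d_def \<Phi>_def blinfun.sum_right blinfun.scaleR_right inner_sum_right mult.commute)
  have "\<psi> d \<le> 0" if "\<psi> \<in> S" for \<psi>
    unfolding d using that by (intro l(1) subsetD[OF closure_subset] imageI)
  moreover have "\<phi> d > 0" unfolding d by (rule l(2))
  ultimately show ?thesis by blast
qed

section \<open>Coordinates with respect to a Riesz basis\<close>

lemma frechet_fderiv:
  "f differentiable at x \<Longrightarrow> (f has_derivative blinfun_apply (fderiv f x)) (at x)"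
  unfolding fderiv_def
  by (metis bounded_linear_Blinfun_apply frechet_derivative_works has_derivative_bounded_linear)

lemma fderiv_eqI:
  assumes "(f has_derivative blinfun_apply A) (at x)"
  shows "fderiv f x = A"
  unfolding fderiv_def frechet_derivative_at[OF assms, symmetric] by (simp add: blinfun_apply_inverse)

lemma fderiv_constr:
  assumes "G differentiable at x"
  shows "fderiv (constr bs G i) x = bs i o\<^sub>L fderiv G x"
proof (rule fderiv_eqI)
  show "(constr bs G i has_derivative blinfun_apply (bs i o\<^sub>L fderiv G x)) (at x)"
    using bounded_linear.has_derivative[OF blinfun.bounded_linear_right frechet_fderiv[OF assms]]
    by (simp add: constr_def[abs_def] blinfun_compose.rep_eq comp_def)
qed

locale riesz_basis =
  fixes b :: "nat \<Rightarrow> 'f::{real_inner, banach}" and bs :: "nat \<Rightarrow> 'f \<Rightarrow>\<^sub>L real"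
  assumes bess: "besselian UNIV b" and hilb: "hilbertian UNIV b"
    and biorthogonal: "\<And>i j. blinfun_apply (bs i) (b j) = (if i = j then 1 else 0)"
    and expansion: "\<And>y. (\<lambda>i. blinfun_apply (bs i) y *\<^sub>R b i) sums y"
begin

definition partial :: "nat set \<Rightarrow> nat \<Rightarrow> 'f \<Rightarrow> 'f" where
  "partial J N y = (\<Sum>i<N. (if i \<in> J then bs i y else 0) *\<^sub>R b i)"

definition supported :: "nat set \<Rightarrow> 'f set" where
  "supported J = {y. \<forall>i. i \<notin> J \<longrightarrow> bs i y = 0}"

lemma coordinate_of_sum:
  assumes "(\<lambda>i. c i *\<^sub>R b i) sums y"
  shows "bs i y = c i"
proof -
  have "(\<lambda>j. bs i (c j *\<^sub>R b j)) sums bs i y"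
    by (rule bounded_linear.sums[OF blinfun.bounded_linear_right assms])
  moreover have "(\<lambda>j. bs i (c j *\<^sub>R b j)) = (\<lambda>j. if j = i then c j else 0)"
    by (auto simp: blinfun.scaleR_right biorthogonal)
  moreover have "(\<lambda>j. if j = i then c j else 0) sums c i" by (rule sums_single)
  ultimately show ?thesis using sums_unique2 by metis
qed

lemma coordinate_partial: "bs i (partial J N y) = (if i \<in> J \<and> i < N then bs i y else 0)"
proof -
  have "bs i (partial J N y) = (\<Sum>j<N. (if j \<in> J then bs j y else 0) * (if i = j then 1 else 0))"
    by (simp add: partial_def blinfun.sum_right blinfun.scaleR_right biorthogonal)
  also have "\<dots> = (\<Sum>j<N. if j = i then (if i \<in> J then bs i y else 0) else 0)"
    by (intro sum.cong) auto
  also have "\<dots> = (if i \<in> J \<and> i < N then bs i y else 0)"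
    by (simp add: sum.delta)
  finally show ?thesis .
qed

lemma square_summable: "summable (\<lambda>i. (bs i y)\<^sup>2)"
  using bess sums_summable[OF expansion[of y]] by (auto simp: besselian_def coeffs_def)

text \<open>
  Convergence of the series restricted to an arbitrary index set \<open>J\<close>: the coordinates are square
  summable by the Besselian property, hence so are the restricted ones, and the Hilbertian
  property turns them back into a convergent series.
\<close>

lemma partial_convergent: "convergent (\<lambda>N. partial J N y)"
proof -
  have "summable (\<lambda>i. (if i \<in> J then bs i y else 0)\<^sup>2)"
    by (rule summable_comparison_test'[OF square_summable[of y], of 0]) auto
  then have "summable (\<lambda>i. (if i \<in> J then bs i y else 0) *\<^sub>R b i)"
    using hilb by (auto simp: hilbertian_def coeffs_def)
  then show ?thesis by (simp add: partial_def summable_iff_convergent)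
qed

lemma linear_partial: "linear (partial J N)"
proof (rule linearI)
  show "partial J N (x + y) = partial J N x + partial J N y" for x y
    unfolding partial_def sum.distrib[symmetric]
    by (intro sum.cong) (auto simp: blinfun.add_right scaleR_add_left)
  show "partial J N (c *\<^sub>R x) = c *\<^sub>R partial J N x" for c x
    unfolding partial_def scaleR_sum_right
    by (intro sum.cong) (auto simp: blinfun.scaleR_right)
qed

lemma partial_bounded:
  obtains M where "M > 0" "\<And>N y. norm (partial J N y) \<le> M * norm y"
proof -
  obtain M where "M > 0" "\<And>N y. y \<in> UNIV \<Longrightarrow> norm (partial J N y) \<le> M * norm y"
  proof (rule uniform_boundedness_seminorms[where X = UNIV and p = "\<lambda>N y. norm (partial J N y)"])
    have "continuous_on UNIV (\<lambda>y. if i \<in> J then bs i y else 0)" for i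
      by (cases "i \<in> J") (auto intro!: continuous_intros)
    then show "continuous_on UNIV (\<lambda>y. norm (partial J N y))" for N
      unfolding partial_def by (intro continuous_intros)
    show "norm (partial J N (x + y)) \<le> norm (partial J N x) + norm (partial J N y)" for N x y
      by (simp add: linear_add[OF linear_partial] norm_triangle_ineq)
    show "norm (partial J N (c *\<^sub>R y)) = \<bar>c\<bar> * norm (partial J N y)" for N c y
      by (simp add: linear_cmul[OF linear_partial])
    show "\<exists>M. \<forall>N. norm (partial J N y) \<le> M" for y
      using convergent_imp_Bseq[OF partial_convergent, of J y] unfolding Bseq_def by blast
  qed auto
  then show thesis using that by blast
qed

definition projection :: "nat set \<Rightarrow> 'f \<Rightarrow>\<^sub>L 'f" where
  "projection J = Blinfun (\<lambda>y. lim (\<lambda>N. partial J N y))"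

lemma partial_tendsto: "(\<lambda>N. partial J N y) \<longlonglongrightarrow> projection J y"
proof -
  let ?P = "\<lambda>y. lim (\<lambda>N. partial J N y)"
  have lim: "(\<lambda>N. partial J N y) \<longlonglongrightarrow> ?P y" for y
    using partial_convergent by (simp add: convergent_LIMSEQ_iff)
  obtain M where M: "\<And>N y. norm (partial J N y) \<le> M * norm y"
    using partial_bounded[of J] by metis
  have "bounded_linear ?P"
  proof (rule bounded_linear_intro[where K = M])
    fix x y and c :: real
    show "?P (x + y) = ?P x + ?P y"
      by (rule LIMSEQ_unique[OF lim]) (simp add: linear_add[OF linear_partial] tendsto_add lim)
    show "?P (c *\<^sub>R x) = c *\<^sub>R ?P x"
      by (rule LIMSEQ_unique[OF lim]) (simp add: linear_cmul[OF linear_partial] tendsto_scaleR lim)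
    have "norm (?P x) \<le> M * norm x"
      by (rule tendsto_upperbound[OF tendsto_norm[OF lim]]) (auto simp: M)
    then show "norm (?P x) \<le> norm x * M" by (simp add: mult.commute)
  qed
  then show ?thesis using lim by (simp add: projection_def bounded_linear_Blinfun_apply)
qed

lemma coordinate_projection: "bs i (projection J y) = (if i \<in> J then bs i y else 0)"
proof (rule coordinate_of_sum)
  show "(\<lambda>i. (if i \<in> J then bs i y else 0) *\<^sub>R b i) sums projection J y"
    using partial_tendsto[of J y] by (simp add: sums_def partial_def)
qed

lemma eq_zero_if_coordinates: "(\<And>i. bs i y = 0) \<Longrightarrow> y = 0"
  using expansion[of y] by (simp add: sums_iff)

lemma projection_eq_zero_iff: "projection J y = 0 \<longleftrightarrow> (\<forall>i\<in>J. bs i y = 0)"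
proof
  assume "projection J y = 0"
  then show "\<forall>i\<in>J. bs i y = 0"
    using coordinate_projection[of _ J y] by (metis blinfun.zero_right)
next
  assume "\<forall>i\<in>J. bs i y = 0"
  then show "projection J y = 0"
    by (intro eq_zero_if_coordinates) (simp add: coordinate_projection)
qed

lemma subspace_supported: "subspace (supported J)"
  by (simp add: subspace_def supported_def blinfun.add_right blinfun.scaleR_right blinfun.zero_right)

lemma projection_supported: "projection J y \<in> supported J"
  by (simp add: supported_def coordinate_projection)

lemma coordinates_l2_bounded:
  obtains M where "M > 0" "\<And>N y. L2_set (\<lambda>i. bs i y) {..<N} \<le> M * norm y"
proof -
  obtain M where "M > 0" "\<And>N y. y \<in> UNIV \<Longrightarrow> L2_set (\<lambda>i. bs i y) {..<N} \<le> M * norm y"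
  proof (rule uniform_boundedness_seminorms[where X = UNIV and p = "\<lambda>N y. L2_set (\<lambda>i. bs i y) {..<N}"])
    show "continuous_on UNIV (\<lambda>y. L2_set (\<lambda>i. bs i y) {..<N})" for N
      unfolding L2_set_def by (intro continuous_intros)
    show "L2_set (\<lambda>i. bs i (x + y)) {..<N} \<le> L2_set (\<lambda>i. bs i x) {..<N} + L2_set (\<lambda>i. bs i y) {..<N}" for N x y
      using L2_set_triangle_ineq by (simp add: blinfun.add_right)
    show "L2_set (\<lambda>i. bs i (c *\<^sub>R y)) {..<N} = \<bar>c\<bar> * L2_set (\<lambda>i. bs i y) {..<N}" for N c y
      by (simp add: L2_set_def blinfun.scaleR_right power_mult_distrib real_sqrt_mult flip: sum_distrib_left)
    show "\<exists>M. \<forall>N. L2_set (\<lambda>i. bs i y) {..<N} \<le> M" for y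
      using sum_le_suminf[OF square_summable] by (intro exI[of _ "sqrt (\<Sum>i. (bs i y)\<^sup>2)"]) (auto simp: L2_set_def)
  qed auto
  then show thesis using that by blast
qed

text \<open>
  The estimate that makes \<open>projection J o\<^sub>L T\<close> map onto \<open>supported J\<close>. The functional
  \<open>\<psi> = adj (projection J o\<^sub>L T) l\<close> is formally \<open>\<Sum>i\<in>J. (l \<bullet> b i) *\<^sub>R \<phi> i\<close>. The partial sums are bounded,
  so bounded completeness makes the series converge in norm, and \<open>\<psi>\<close> lies in \<open>X\<close> with the coefficients
  \<open>l \<bullet> b i = \<psi> (e i)\<close>. The Besselian property and uniform boundedness (applicable since evaluations
  at \<open>e i\<close> are continuous) bound the Euclidean norm of these coefficients by a multiple of \<open>norm \<psi>\<close>,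
  and the Cauchy-Schwarz inequality bounds \<open>l \<bullet> w\<close>.
\<close>

lemma adjoint_bounded_below:
  fixes T :: "'e::real_normed_vector \<Rightarrow>\<^sub>L 'f" and X :: "('e \<Rightarrow>\<^sub>L real) set"
  defines "\<phi> \<equiv> \<lambda>i. bs i o\<^sub>L T"
  assumes X: "schauder_basis J \<phi> X" and "boundedly_complete J \<phi>" and "besselian J \<phi>"
    and e: "\<And>i \<psi>. i \<in> J \<Longrightarrow> \<psi> \<in> X \<Longrightarrow> biorth J \<phi> i \<psi> = blinfun_apply \<psi> (e i)"
  obtains C where "C > 0"
    "\<And>l w. w \<in> supported J \<Longrightarrow> l \<bullet> w \<le> C * norm w * norm (adj (projection J o\<^sub>L T) l)"
proof -
  have X_sub: "subspace X" "closed X" and \<phi>_X: "\<And>i. i \<in> J \<Longrightarrow> \<phi> i \<in> X"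
    and uniq: "\<And>\<psi>. \<psi> \<in> X \<Longrightarrow> \<exists>!a. a \<in> coeffs J \<and> (\<lambda>i. a i *\<^sub>R \<phi> i) sums \<psi>"
    using X by (auto simp: schauder_basis_def)
  have coeff: "a i = \<psi> (e i)" if "\<psi> \<in> X" "i \<in> J" "a \<in> coeffs J" "(\<lambda>i. a i *\<^sub>R \<phi> i) sums \<psi>" for a i \<psi>
    using the1_equality[OF uniq[OF that(1)], of a] that e[OF that(2,1)] by (simp add: biorth_def)
  let ?c = "\<lambda>\<psi> i. if i \<in> J then blinfun_apply \<psi> (e i) else 0"
  obtain M where M: "M > 0" "\<And>N y. L2_set (\<lambda>i. bs i y) {..<N} \<le> M * norm y"
    using coordinates_l2_bounded by metis
  obtain M' where M': "M' > 0" "\<And>N \<psi>. \<psi> \<in> X \<Longrightarrow> L2_set (?c \<psi>) {..<N} \<le> M' * norm \<psi>"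
  proof (rule uniform_boundedness_seminorms[where X = X and p = "\<lambda>N \<psi>. L2_set (?c \<psi>) {..<N}"])
    have "continuous_on UNIV (\<lambda>\<psi>. ?c \<psi> i)" for i
      by (cases "i \<in> J") (auto intro!: continuous_intros)
    then show "continuous_on UNIV (\<lambda>\<psi>. L2_set (?c \<psi>) {..<N})" for N
      unfolding L2_set_def by (intro continuous_intros)
    show "L2_set (?c (\<psi> + \<eta>)) {..<N} \<le> L2_set (?c \<psi>) {..<N} + L2_set (?c \<eta>) {..<N}" for N \<psi> \<eta>
    proof -
      have "?c (\<psi> + \<eta>) = (\<lambda>i. ?c \<psi> i + ?c \<eta> i)" by (auto simp: blinfun.add_left)
      then show ?thesis using L2_set_triangle_ineq[of "?c \<psi>" "?c \<eta>"] by simp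
    qed
    show "L2_set (?c (k *\<^sub>R \<psi>)) {..<N} = \<bar>k\<bar> * L2_set (?c \<psi>) {..<N}" for N k \<psi>
    proof -
      have "?c (k *\<^sub>R \<psi>) = (\<lambda>i. k * ?c \<psi> i)" by (auto simp: blinfun.scaleR_left)
      then show ?thesis
        by (simp add: L2_set_def power_mult_distrib real_sqrt_mult flip: sum_distrib_left)
    qed
    show "\<exists>M. \<forall>N. L2_set (?c \<psi>) {..<N} \<le> M" if \<psi>: "\<psi> \<in> X" for \<psi>
    proof -
      obtain a where a: "a \<in> coeffs J" "(\<lambda>i. a i *\<^sub>R \<phi> i) sums \<psi>" using uniq[OF \<psi>] by blast
      have "?c \<psi> = a" using coeff[OF \<psi> _ a] a(1) by (auto simp: coeffs_def)
      moreover have "summable (\<lambda>i. (a i)\<^sup>2)"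
        using \<open>besselian J \<phi>\<close> a sums_summable[OF a(2)] by (simp add: besselian_def)
      ultimately show ?thesis
        using sum_le_suminf[of "\<lambda>i. (a i)\<^sup>2"]
        by (intro exI[of _ "sqrt (\<Sum>i. (a i)\<^sup>2)"]) (simp add: L2_set_def)
    qed
  qed (use X_sub in auto)
  have "l \<bullet> w \<le> (M * M') * norm w * norm (adj (projection J o\<^sub>L T) l)" if w: "w \<in> supported J" for l w
  proof -
    define \<alpha> where "\<alpha> i = (if i \<in> J then l \<bullet> b i else 0)" for i
    define \<psi> where "\<psi> = adj (projection J o\<^sub>L T) l"
    have \<alpha>: "\<alpha> \<in> coeffs J" by (simp add: \<alpha>_def coeffs_def)
    have partial_sum: "(\<Sum>i<N. \<alpha> i *\<^sub>R \<phi> i) v = l \<bullet> partial J N (T v)" for N v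
      by (auto simp: \<phi>_def \<alpha>_def partial_def blinfun.sum_left blinfun.scaleR_left inner_sum_right intro!: sum.cong)
    obtain M\<^sub>0 where M\<^sub>0: "M\<^sub>0 > 0" "\<And>N y. norm (partial J N y) \<le> M\<^sub>0 * norm y"
      using partial_bounded[of J] by metis
    have "norm (\<Sum>i<N. \<alpha> i *\<^sub>R \<phi> i) \<le> norm l * (M\<^sub>0 * norm T)" for N
    proof (rule norm_blinfun_bound)
      show "0 \<le> norm l * (M\<^sub>0 * norm T)" using M\<^sub>0 by simp
      fix v
      have "norm ((\<Sum>i<N. \<alpha> i *\<^sub>R \<phi> i) v) \<le> norm l * norm (partial J N (T v))"
        unfolding partial_sum real_norm_def by (rule Cauchy_Schwarz_ineq2)
      also have "norm (partial J N (T v)) \<le> M\<^sub>0 * norm (T v)" by (rule M\<^sub>0)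
      also have "norm (T v) \<le> norm T * norm v" by (rule norm_blinfun)
      finally show "norm ((\<Sum>i<N. \<alpha> i *\<^sub>R \<phi> i) v) \<le> norm l * (M\<^sub>0 * norm T) * norm v"
        using M\<^sub>0 by (simp add: mult.assoc mult_left_mono)
    qed
    then have "bounded (range (\<lambda>N. \<Sum>i<N. \<alpha> i *\<^sub>R \<phi> i))"
      by (auto simp: bounded_iff)
    then have "summable (\<lambda>i. \<alpha> i *\<^sub>R \<phi> i)"
      using \<open>boundedly_complete J \<phi>\<close> \<alpha> by (simp add: boundedly_complete_def)
    then obtain \<eta> where \<eta>: "(\<lambda>i. \<alpha> i *\<^sub>R \<phi> i) sums \<eta>" by (auto simp: summable_def)
    have "\<eta> = \<psi>"
    proof (rule blinfun_eqI)
      fix v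
      have "(\<lambda>N. (\<Sum>i<N. \<alpha> i *\<^sub>R \<phi> i) v) \<longlonglongrightarrow> \<eta> v"
        using \<eta> unfolding sums_def by (intro tendsto_intros)
      moreover have "(\<lambda>N. l \<bullet> partial J N (T v)) \<longlonglongrightarrow> l \<bullet> projection J (T v)"
        by (intro tendsto_intros partial_tendsto)
      ultimately have "\<eta> v = l \<bullet> projection J (T v)"
        unfolding partial_sum by (rule LIMSEQ_unique)
      then show "\<eta> v = \<psi> v" by (simp add: \<psi>_def adj_def)
    qed
    with \<eta> have \<psi>: "(\<lambda>i. \<alpha> i *\<^sub>R \<phi> i) sums \<psi>" by simp
    have "(\<Sum>i<N. \<alpha> i *\<^sub>R \<phi> i) \<in> X" for N
    proof (intro subspace_sum X_sub)
      show "\<alpha> i *\<^sub>R \<phi> i \<in> X" for i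
        using \<phi>_X[of i] X_sub(1) by (cases "i \<in> J") (auto simp: \<alpha>_def subspace_scale subspace_0)
    qed
    then have \<psi>_X: "\<psi> \<in> X" by (rule closed_sequentially[OF X_sub(2) _ \<psi>[unfolded sums_def]])
    have c_eq: "?c \<psi> = \<alpha>" using coeff[OF \<psi>_X _ \<alpha> \<psi>] by (auto simp: \<alpha>_def)
    have "l \<bullet> partial UNIV N w \<le> (M * M') * norm w * norm \<psi>" for N
    proof -
      have "l \<bullet> partial UNIV N w = (\<Sum>i<N. bs i w * \<alpha> i)"
        using w by (auto simp: partial_def inner_sum_right \<alpha>_def supported_def intro!: sum.cong)
      also have "\<dots> \<le> (\<Sum>i<N. \<bar>bs i w\<bar> * \<bar>\<alpha> i\<bar>)"
        by (intro sum_mono) (simp flip: abs_mult)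
      also have "\<dots> \<le> L2_set (\<lambda>i. bs i w) {..<N} * L2_set \<alpha> {..<N}"
        by (rule L2_set_mult_ineq)
      also have "\<dots> \<le> (M * norm w) * (M' * norm \<psi>)"
        using M M' M'(2)[OF \<psi>_X, of N] unfolding c_eq by (intro mult_mono) (auto simp: L2_set_nonneg)
      finally show ?thesis by (simp add: algebra_simps)
    qed
    moreover have "(\<lambda>N. l \<bullet> partial UNIV N w) \<longlonglongrightarrow> l \<bullet> w"
      using expansion[of w] by (intro tendsto_intros) (simp add: partial_def sums_def)
    ultimately show ?thesis
      unfolding \<psi>_def by (intro tendsto_upperbound) auto
  qed
  then show thesis using M M' by (intro that[of "M * M'"]) auto
qed

end

section \<open>Curves under the constant rank condition\<close>

context riesz_basis
begin

text \<open>
  The curve is built for \<open>H = projection J\<^sub>2 \<circ> G\<close> only. Its derivative has the functionals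
  \<open>Dg\<^sub>j(x)\<close>, \<open>j \<in> J\<^sub>2\<close>, as coordinates, so each \<open>Dg\<^sub>i(x)\<close>, \<open>i \<in> J\<close>, being a convergent series of these,
  vanishes on its kernel, and \<open>constant_on_level\<close> carries all the \<open>g\<^sub>i\<close> along.
\<close>

lemma constant_rank_curve:
  fixes G :: "'e::banach \<Rightarrow> 'f"
  assumes G: "C1_map G" and CRC: "CRC_plus b (constr bs G) x\<^sub>0 V J J\<^sub>2" and V: "x\<^sub>0 \<in> interior V"
    and d: "\<And>i. i \<in> J \<Longrightarrow> bs i (fderiv G x\<^sub>0 d) = 0"
  obtains r where "((\<lambda>t. norm (r t) / t) \<longlongrightarrow> 0) (at_right 0)"
    "\<forall>\<^sub>F t in at_right 0. \<forall>i\<in>J. constr bs G i (x\<^sub>0 + t *\<^sub>R d + r t) = constr bs G i x\<^sub>0"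
proof -
  have diff: "G differentiable at x" for x using G by (simp add: C1_map_def)
  have DG: "(G has_derivative fderiv G x) (at x)" for x by (rule frechet_fderiv[OF diff])
  define \<phi> where "\<phi> x i = bs i o\<^sub>L fderiv G x" for x i
  have \<phi>: "fderiv (constr bs G i) x = \<phi> x i" for x i
    unfolding \<phi>_def by (rule fderiv_constr[OF diff])
  have J\<^sub>2: "J\<^sub>2 \<subseteq> J"
    and span: "\<And>x. x \<in> V \<Longrightarrow> schauder_basis J\<^sub>2 (\<phi> x) (closed_span (\<phi> x ` J))"
    and bc: "boundedly_complete J\<^sub>2 (\<phi> x\<^sub>0)" and bes: "besselian J\<^sub>2 (\<phi> x\<^sub>0)"
    and ev: "\<forall>i\<in>J\<^sub>2. \<exists>e. \<forall>\<psi>\<in>closed_span (\<phi> x\<^sub>0 ` J). biorth J\<^sub>2 (\<phi> x\<^sub>0) i \<psi> = blinfun_apply \<psi> e"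
    using CRC by (simp_all add: CRC_plus_def \<phi> Let_def)
  obtain e where e: "\<And>i \<psi>. i \<in> J\<^sub>2 \<Longrightarrow> \<psi> \<in> closed_span (\<phi> x\<^sub>0 ` J) \<Longrightarrow>
      biorth J\<^sub>2 (\<phi> x\<^sub>0) i \<psi> = blinfun_apply \<psi> (e i)"
    using bchoice[OF ev] by blast
  have x\<^sub>0: "x\<^sub>0 \<in> V" using V interior_subset by blast
  let ?P = "projection J\<^sub>2"
  define A where "A x = ?P o\<^sub>L fderiv G x" for x
  define H where "H x = ?P (G x)" for x
  obtain C where C: "C > 0"
    "\<And>l w. w \<in> supported J\<^sub>2 \<Longrightarrow> l \<bullet> w \<le> C * norm w * norm (adj (A x\<^sub>0) l)"
    unfolding A_def
    using adjoint_bounded_below[of J\<^sub>2 "fderiv G x\<^sub>0" "closed_span (\<phi> x\<^sub>0 ` J)" e] span[OF x\<^sub>0] bc bes e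
    unfolding \<phi>_def by metis
  define \<epsilon> where "\<epsilon> = 1 / (16 * C * (norm ?P + 1))"
  have P: "norm ?P + 1 > 0" by (simp add: add_nonneg_pos)
  have \<epsilon>: "\<epsilon> > 0" using C P by (simp add: \<epsilon>_def)
  obtain \<delta> where \<delta>: "\<delta> > 0" "\<And>x. dist x x\<^sub>0 < \<delta> \<Longrightarrow> norm (fderiv G x - fderiv G x\<^sub>0) < \<epsilon>"
    using G \<epsilon> unfolding C1_map_def continuous_on_iff dist_norm[of "fderiv G _"] by (metis UNIV_I)
  obtain \<delta>' where \<delta>': "\<delta>' > 0" "ball x\<^sub>0 \<delta>' \<subseteq> V" using V mem_interior by blast
  define \<rho> where "\<rho> = min \<delta> \<delta>' / 2"
  have \<rho>: "0 < \<rho>" "\<rho> < \<delta>" "\<rho> < \<delta>'" using \<delta>(1) \<delta>'(1) by (auto simp: \<rho>_def min_def)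
  have in_V: "x \<in> V" if "x \<in> cball x\<^sub>0 \<rho>" for x
    using that \<rho> \<delta>'(2) by (auto simp: subset_iff)
  interpret almost_submersion H A x\<^sub>0 "supported J\<^sub>2" C \<rho>
  proof
    show "subspace (supported J\<^sub>2)" by (rule subspace_supported)
    show "H x \<in> supported J\<^sub>2" "A x v \<in> supported J\<^sub>2" for x v
      by (simp_all add: H_def A_def projection_supported)
    show "\<exists>e. norm e \<le> C * norm w \<and> norm (w - A x\<^sub>0 e) \<le> norm w / 4" if "w \<in> supported J\<^sub>2" for w
      by (intro almost_open_if_adjoint_bounded_below C that)
    show "(H has_derivative A x) (at x)" for x
      using bounded_linear.has_derivative[OF blinfun.bounded_linear_right DG]
      by (simp add: H_def[abs_def] A_def blinfun_compose.rep_eq comp_def)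
    show "C * norm (A x - A x\<^sub>0) \<le> 1 / 16" if x: "x \<in> cball x\<^sub>0 \<rho>" for x
    proof -
      have "A x - A x\<^sub>0 = ?P o\<^sub>L (fderiv G x - fderiv G x\<^sub>0)"
        by (rule blinfun_eqI) (simp add: A_def blinfun.diff_left blinfun.diff_right)
      then have "norm (A x - A x\<^sub>0) \<le> norm ?P * norm (fderiv G x - fderiv G x\<^sub>0)"
        by (simp add: norm_blinfun_compose)
      also have "\<dots> \<le> (norm ?P + 1) * \<epsilon>"
        using \<delta>(2)[of x] x \<rho> by (intro mult_mono) (auto simp: dist_commute)
      finally have "C * norm (A x - A x\<^sub>0) \<le> C * ((norm ?P + 1) * \<epsilon>)" using C by simp
      also have "\<dots> = 1 / 16"
      proof -
        have "C * (a * (1 / (16 * C * a))) = 1 / 16" if "a > 0" for a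
          using C(1) that by (simp add: field_simps)
        then show ?thesis unfolding \<epsilon>_def using P by blast
      qed
      finally show ?thesis .
    qed
  qed (use C \<rho> in auto)
  have "A x\<^sub>0 d = 0" using d J\<^sub>2 by (auto simp: A_def projection_eq_zero_iff)
  then obtain r where r: "((\<lambda>t. norm (r t) / t) \<longlongrightarrow> 0) (at_right 0)"
    "\<forall>\<^sub>F t in at_right 0. x\<^sub>0 + t *\<^sub>R d + r t \<in> cball x\<^sub>0 \<rho> \<and> H (x\<^sub>0 + t *\<^sub>R d + r t) = H x\<^sub>0"
    using Ljusternik_curve by blast
  have level: "constr bs G i p = constr bs G i x\<^sub>0"
    if i: "i \<in> J" and p: "p \<in> cball x\<^sub>0 \<rho>" "H p = H x\<^sub>0" for i p
  proof (rule constant_on_level[where T = "\<lambda>x. \<phi> x i", OF p])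
    show "(constr bs G i has_derivative \<phi> x i) (at x)" for x
      using bounded_linear.has_derivative[OF blinfun.bounded_linear_right DG]
      by (simp add: constr_def[abs_def] \<phi>_def blinfun_compose.rep_eq comp_def)
    show "\<phi> x i v = 0" if x: "x \<in> cball x\<^sub>0 \<rho>" and v: "A x v = 0" for x v
    proof -
      have "\<phi> x i \<in> closed_span (\<phi> x ` J)"
        unfolding closed_span_def using i by (intro subsetD[OF closure_subset] span_base imageI)
      then obtain a where a: "a \<in> coeffs J\<^sub>2" "(\<lambda>j. a j *\<^sub>R \<phi> x j) sums \<phi> x i"
        using span[OF in_V[OF x]] unfolding schauder_basis_def by blast
      have "(\<lambda>j. (a j *\<^sub>R \<phi> x j) v) sums \<phi> x i v"
        by (rule bounded_linear.sums[OF blinfun.bounded_linear_left a(2)])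
      moreover have "(a j *\<^sub>R \<phi> x j) v = 0" for j
        using a(1) v by (cases "j \<in> J\<^sub>2")
          (auto simp: A_def projection_eq_zero_iff \<phi>_def coeffs_def blinfun.scaleR_left)
      ultimately show ?thesis by (simp add: sums_iff)
    qed
  qed
  show thesis
    using r level by (intro that[of r]) (auto elim: eventually_mono)
qed

end

section \<open>The tangent cone of the constraint cone\<close>

context riesz_basis
begin

lemma tangent_cone_equality_coordinates:
  assumes y: "y \<in> constraint_cone bs I\<^sub>0 I\<^sub>1" and h: "h \<in> tangent_cone (constraint_cone bs I\<^sub>0 I\<^sub>1) y"
    and i: "i \<in> I\<^sub>0"
  shows "bs i h = 0"
proof -
  obtain xs :: "nat \<Rightarrow> 'f" and t :: "nat \<Rightarrow> real" where
    xs: "\<And>k. xs k \<in> constraint_cone bs I\<^sub>0 I\<^sub>1" "(\<lambda>k. (xs k - y) /\<^sub>R t k) \<longlonglongrightarrow> h"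
    using h by (auto simp: tangent_cone_def)
  have "(\<lambda>k. bs i ((xs k - y) /\<^sub>R t k)) \<longlonglongrightarrow> bs i h" by (intro tendsto_intros xs)
  moreover have "bs i ((xs k - y) /\<^sub>R t k) = 0" for k
    using xs(1)[of k] y i by (simp add: constraint_cone_def blinfun.scaleR_right blinfun.diff_right)
  ultimately show ?thesis by (simp add: LIMSEQ_const_iff)
qed

text \<open>
  The finite truncations of \<open>h\<close> involve finitely many constraints, which stay satisfied for small
  steps: the inactive ones by continuity, the active ones by the sign of \<open>bs i h\<close>. As the truncations
  converge to \<open>h\<close>, a diagonal choice of step lengths shows that \<open>h\<close> is tangent.
\<close>

lemma tangent_coneI:
  assumes y: "y \<in> constraint_cone bs I\<^sub>0 I\<^sub>1" and I: "I\<^sub>0 \<union> I\<^sub>1 = UNIV"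
    and eq: "\<And>i. i \<in> I\<^sub>0 \<Longrightarrow> bs i h = 0"
    and act: "\<And>i. i \<in> I\<^sub>1 \<Longrightarrow> bs i y = 0 \<Longrightarrow> bs i h \<le> 0"
  shows "h \<in> tangent_cone (constraint_cone bs I\<^sub>0 I\<^sub>1) y"
proof -
  have "\<exists>t>0. t < inverse (real (Suc n)) \<and> (\<forall>i\<in>{..<n} \<inter> I\<^sub>1. bs i y + t * bs i h \<le> 0)" for n
  proof -
    have "\<forall>\<^sub>F t in at_right 0. bs i y + t * bs i h \<le> 0" if "i \<in> I\<^sub>1" for i
    proof (cases "bs i y = 0")
      case True
      have "bs i y + t * bs i h \<le> 0" if "t > 0" for t
        using act[OF \<open>i \<in> I\<^sub>1\<close> True] True that by (simp add: mult_nonneg_nonpos)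
      then show ?thesis by (intro eventually_mono[OF eventually_at_right_less[of 0]])
    next
      case False
      then have neg: "bs i y < 0" using y that by (auto simp: constraint_cone_def order_less_le)
      have "((\<lambda>t. bs i y + t * bs i h) \<longlongrightarrow> bs i y + 0 * bs i h) (at_right 0)"
        by (intro tendsto_intros)
      then have "\<forall>\<^sub>F t in at_right 0. bs i y + t * bs i h < 0"
        using neg by (intro order_tendstoD(2)) auto
      then show ?thesis by (rule eventually_mono) simp
    qed
    then have "\<forall>\<^sub>F t in at_right 0. \<forall>i\<in>{..<n} \<inter> I\<^sub>1. bs i y + t * bs i h \<le> 0"
      by (intro eventually_ball_finite) auto
    moreover have "\<forall>\<^sub>F t in at_right (0::real). t < inverse (real (Suc n))"
      by (intro order_tendstoD(2)[OF tendsto_ident_at]) simp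
    moreover have "\<forall>\<^sub>F t in at_right (0::real). t > 0" by (rule eventually_at_right_less)
    ultimately have "\<forall>\<^sub>F t in at_right 0. t > 0 \<and> t < inverse (real (Suc n)) \<and>
        (\<forall>i\<in>{..<n} \<inter> I\<^sub>1. bs i y + t * bs i h \<le> 0)"
      by eventually_elim simp
    then show ?thesis using eventually_happens'[OF trivial_limit_at_right_real] by blast
  qed
  then obtain t where t: "\<And>n. t n > 0" "\<And>n. t n < inverse (real (Suc n))"
    "\<And>n i. i < n \<Longrightarrow> i \<in> I\<^sub>1 \<Longrightarrow> bs i y + t n * bs i h \<le> 0"
    by (metis Int_iff lessThan_iff)
  define xs where "xs n = y + t n *\<^sub>R partial UNIV n h" for n
  have part: "(\<lambda>n. partial UNIV n h) \<longlonglongrightarrow> h"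
    using expansion[of h] by (simp add: partial_def sums_def)
  have t0: "t \<longlonglongrightarrow> 0"
    by (rule tendsto_sandwich[OF _ _ tendsto_const LIMSEQ_inverse_real_of_nat])
      (use t in \<open>auto intro!: always_eventually less_imp_le\<close>)
  have "xs n \<in> constraint_cone bs I\<^sub>0 I\<^sub>1" for n
    using y eq t(3)[of _ n]
    by (auto simp: xs_def constraint_cone_def blinfun.add_right blinfun.scaleR_right coordinate_partial)
  moreover have "xs \<longlonglongrightarrow> y"
    using tendsto_add[OF tendsto_const[of y] tendsto_scaleR[OF t0 part]] by (simp add: xs_def[abs_def])
  moreover have "(\<lambda>n. (xs n - y) /\<^sub>R t n) \<longlonglongrightarrow> h"
  proof -
    have "(xs n - y) /\<^sub>R t n = partial UNIV n h" for n using t(1)[of n] by (simp add: xs_def)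
    then show ?thesis using part by simp
  qed
  ultimately show ?thesis using t(1) t0 by (auto simp: tangent_cone_def intro!: exI[of _ xs] exI[of _ t])
qed

text \<open>
  The bipolar theorem for \<open>K\<close>. The cone \<open>S\<close> of directions described by coordinates is closed and
  contains \<open>K - y\<close>, so a vector separating \<open>h\<close> from \<open>S\<close> would be a normal vector violating the
  hypothesis.
\<close>

lemma polar_of_normal_cone_tangent:
  assumes y: "y \<in> constraint_cone bs I\<^sub>0 I\<^sub>1" and I: "I\<^sub>0 \<union> I\<^sub>1 = UNIV"
    and polar: "\<And>l. l \<in> normal_cone (constraint_cone bs I\<^sub>0 I\<^sub>1) y \<Longrightarrow> l \<bullet> h \<le> 0"
  shows "h \<in> tangent_cone (constraint_cone bs I\<^sub>0 I\<^sub>1) y"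
proof -
  define S where "S = {h. (\<forall>i\<in>I\<^sub>0. bs i h = 0) \<and> (\<forall>i\<in>{i \<in> I\<^sub>1. bs i y = 0}. bs i h \<le> 0)}"
  have "closed S"
  proof -
    have "S = (\<Inter>i\<in>I\<^sub>0. {h. bs i h = 0}) \<inter> (\<Inter>i\<in>{i \<in> I\<^sub>1. bs i y = 0}. {h. bs i h \<le> 0})"
      by (auto simp: S_def)
    also have "closed \<dots>"
      by (intro closed_Int closed_INT ballI closed_Collect_eq closed_Collect_le continuous_intros)
    finally show ?thesis .
  qed
  moreover have "convex S"
    by (rule convexI) (auto simp: S_def blinfun.add_right blinfun.scaleR_right intro!: add_nonpos_nonpos mult_nonneg_nonpos)
  moreover have "cone S"
    by (auto simp: cone_def S_def blinfun.scaleR_right intro!: mult_nonneg_nonpos)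
  moreover have "0 \<in> S" by (simp add: S_def blinfun.zero_right)
  moreover have "h \<in> S"
  proof (rule ccontr)
    assume "h \<notin> S"
    then obtain l where l: "\<And>s. s \<in> S \<Longrightarrow> l \<bullet> s \<le> 0" "l \<bullet> h > 0"
      using closed_convex_cone_separation[of S h] calculation by blast
    have "k - y \<in> S" if "k \<in> constraint_cone bs I\<^sub>0 I\<^sub>1" for k
      using that y by (auto simp: S_def constraint_cone_def blinfun.diff_right)
    then have "l \<in> normal_cone (constraint_cone bs I\<^sub>0 I\<^sub>1) y"
      using l(1) by (simp add: normal_cone_def)
    then show False using polar l(2) by force
  qed
  ultimately show ?thesis using y I by (intro tangent_coneI) (auto simp: S_def)
qed

end

section \<open>Existence of Lagrange multipliers\<close>

theorem proposition8p4:
  fixes b :: "nat \<Rightarrow> 'f::{real_inner, banach}"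
    and bs :: "nat \<Rightarrow> 'f \<Rightarrow>\<^sub>L real"
    and I\<^sub>0 I\<^sub>1 :: "nat set"
    and f\<^sub>0 :: "'e::banach \<Rightarrow> real"
    and G :: "'e \<Rightarrow> 'f"
    and x\<^sub>0 :: 'e
    and V :: "'e set"
  defines "g \<equiv> constr bs G"
    and "K \<equiv> constraint_cone bs I\<^sub>0 I\<^sub>1"
  assumes basis: "schauder_basis UNIV b UNIV"
    and bess: "besselian UNIV b"
    and hilb: "hilbertian UNIV b"
    and biorthogonal: "\<And>i j. blinfun_apply (bs i) (b j) = (if i = j then 1 else 0)"
    and expansion: "\<And>y. (\<lambda>i. blinfun_apply (bs i) y *\<^sub>R b i) sums y"
    and indices: "I\<^sub>0 \<union> I\<^sub>1 = UNIV" "I\<^sub>0 \<inter> I\<^sub>1 = {}"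
    and f0_C1: "C1_map f\<^sub>0"
    and G_C1: "C1_map G"
    and x0_min: "local_minimizer_on f\<^sub>0 {x. G x \<in> K} x\<^sub>0"
    and rcrcq: "RCRCQ_plus b g I\<^sub>0 I\<^sub>1 x\<^sub>0 V"
    and inactive: "\<And>d r. \<lbrakk>d \<in> linearized_cone K G x\<^sub>0;
        ((\<lambda>t::real. norm (r t) / t) \<longlongrightarrow> 0) (at_right 0)\<rbrakk> \<Longrightarrow>
        \<exists>\<epsilon>. 0 < \<epsilon> \<and> \<epsilon> \<le> 1 \<and>
          (\<forall>i\<in>I\<^sub>1 - active_dir g I\<^sub>1 x\<^sub>0 d. \<forall>t\<in>{0<..<\<epsilon>}. g i (x\<^sub>0 + t *\<^sub>R d + r t) \<le> 0)"
    and weak_star_closed: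
      "closedin weak_star_topology (adj (fderiv G x\<^sub>0) ` normal_cone K (G x\<^sub>0))"
  shows "lagrange_multipliers f\<^sub>0 G K x\<^sub>0 \<noteq> {} \<and>
    (\<exists>l\<in>normal_cone K (G x\<^sub>0). fderiv f\<^sub>0 x\<^sub>0 + adj (fderiv G x\<^sub>0) l = 0)"
proof -
  interpret riesz_basis b bs
    using bess hilb biorthogonal expansion by unfold_locales
  let ?A = "fderiv G x\<^sub>0" and ?N = "normal_cone K (G x\<^sub>0)"
  have DG: "(G has_derivative ?A) (at x\<^sub>0)" and Df: "(f\<^sub>0 has_derivative fderiv f\<^sub>0 x\<^sub>0) (at x\<^sub>0)"
    using f0_C1 G_C1 by (auto simp: C1_map_def intro!: frechet_fderiv)
  have x0_K: "G x\<^sub>0 \<in> K" using x0_min by (simp add: local_minimizer_on_def)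
  have Dg: "fderiv (g i) x\<^sub>0 = bs i o\<^sub>L ?A" for i
    unfolding g_def using G_C1 by (intro fderiv_constr) (simp add: C1_map_def)

  \<comment> \<open>Every linearized direction is tangent to the feasible set, so \<open>f\<^sub>0\<close> cannot decrease along it.\<close>
  have descent: "fderiv f\<^sub>0 x\<^sub>0 d \<ge> 0" if d: "d \<in> linearized_cone K G x\<^sub>0" for d
  proof -
    let ?J = "I\<^sub>0 \<union> active_dir g I\<^sub>1 x\<^sub>0 d"
    have "active_dir g I\<^sub>1 x\<^sub>0 d \<subseteq> active g I\<^sub>1 x\<^sub>0" by (auto simp: active_dir_def)
    then obtain J\<^sub>2 where J\<^sub>2: "CRC_plus b (constr bs G) x\<^sub>0 V ?J J\<^sub>2" and V: "x\<^sub>0 \<in> interior V"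
      using rcrcq unfolding RCRCQ_plus_def g_def by (meson Un_mono Un_upper1 order_refl)
    have zero: "bs i (?A d) = 0" if "i \<in> ?J" for i
      using that d x0_K tangent_cone_equality_coordinates[of "G x\<^sub>0" I\<^sub>0 I\<^sub>1 "?A d" i]
      by (auto simp: active_dir_def Dg linearized_cone_def K_def)
    obtain r where r: "((\<lambda>t. norm (r t) / t) \<longlongrightarrow> 0) (at_right 0)"
      "\<forall>\<^sub>F t in at_right 0. \<forall>i\<in>?J. g i (x\<^sub>0 + t *\<^sub>R d + r t) = g i x\<^sub>0"
      using constant_rank_curve[OF G_C1 J\<^sub>2 V zero] unfolding g_def by blast
    let ?x = "\<lambda>t. x\<^sub>0 + t *\<^sub>R d + r t"
    obtain \<epsilon> where \<epsilon>: "\<epsilon> > 0"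
      "\<And>i t. i \<in> I\<^sub>1 - active_dir g I\<^sub>1 x\<^sub>0 d \<Longrightarrow> t \<in> {0<..<\<epsilon>} \<Longrightarrow> g i (?x t) \<le> 0"
      using inactive[OF d r(1)] by blast
    have pos: "\<forall>\<^sub>F t in at_right (0::real). t > 0" by (rule eventually_at_right_less)
    have "\<forall>\<^sub>F t in at_right (0::real). t < \<epsilon>" using \<epsilon>(1) by (intro order_tendstoD(2)[OF tendsto_ident_at])
    with pos r(2) have feasible: "\<forall>\<^sub>F t in at_right 0. G (?x t) \<in> K"
    proof eventually_elim
      case (elim t)
      have "g i (?x t) = 0" if "i \<in> I\<^sub>0" for i
        using elim that x0_K by (simp add: g_def constr_def K_def constraint_cone_def)
      moreover have "g i (?x t) \<le> 0" if "i \<in> I\<^sub>1" for i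
        using elim that \<epsilon>(2)[of i t]
        by (cases "i \<in> active_dir g I\<^sub>1 x\<^sub>0 d") (auto simp: active_dir_def active_def)
      ultimately show ?case by (simp add: g_def constr_def K_def constraint_cone_def)
    qed
    have r0: "((\<lambda>t. r t /\<^sub>R t) \<longlongrightarrow> 0) (at_right 0)"
    proof (rule tendsto_norm_zero_cancel, rule Lim_transform_eventually[OF r(1)])
      show "\<forall>\<^sub>F t in at_right 0. norm (r t) / t = norm (r t /\<^sub>R t)"
        using pos by eventually_elim (simp add: divide_inverse mult.commute)
    qed
    have quot: "((\<lambda>t. (?x t - x\<^sub>0) /\<^sub>R t) \<longlongrightarrow> d) (at_right 0)"
    proof (rule Lim_transform_eventually)
      show "((\<lambda>t. d + r t /\<^sub>R t) \<longlongrightarrow> d) (at_right 0)"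
        using tendsto_add[OF tendsto_const r0] by simp
      show "\<forall>\<^sub>F t in at_right 0. d + r t /\<^sub>R t = (?x t - x\<^sub>0) /\<^sub>R t"
        using pos by eventually_elim (simp add: scaleR_add_right)
    qed
    have x_lim: "(?x \<longlongrightarrow> x\<^sub>0) (at_right 0)"
    proof (rule Lim_transform_eventually)
      show "((\<lambda>t. x\<^sub>0 + t *\<^sub>R ((?x t - x\<^sub>0) /\<^sub>R t)) \<longlongrightarrow> x\<^sub>0) (at_right 0)"
        using tendsto_add[OF tendsto_const tendsto_scaleR[OF tendsto_ident_at quot]] by simp
      show "\<forall>\<^sub>F t in at_right 0. x\<^sub>0 + t *\<^sub>R ((?x t - x\<^sub>0) /\<^sub>R t) = ?x t"
        using pos by eventually_elim simp
    qed
    obtain \<delta> where \<delta>: "\<delta> > 0" "\<And>y. G y \<in> K \<Longrightarrow> dist y x\<^sub>0 < \<delta> \<Longrightarrow> f\<^sub>0 x\<^sub>0 \<le> f\<^sub>0 y"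
      using x0_min unfolding local_minimizer_on_def by blast
    have better: "\<forall>\<^sub>F t in at_right 0. f\<^sub>0 x\<^sub>0 \<le> f\<^sub>0 (?x t)"
      using feasible tendstoD[OF x_lim \<delta>(1)] by eventually_elim (rule \<delta>(2))
    show ?thesis
    proof (rule ccontr)
      assume "\<not> ?thesis"
      then have neg: "fderiv f\<^sub>0 x\<^sub>0 d < 0" by simp
      \<comment> \<open>This \<open>\<eta>\<close> makes the first-order error at most half of the supposed decrease.\<close>
      define \<eta> where "\<eta> = - fderiv f\<^sub>0 x\<^sub>0 d / (2 * (norm d + 1))"
      have nd: "norm d + 1 > 0" by (simp add: add_nonneg_pos)
      have \<eta>: "\<eta> > 0" using neg nd by (simp add: \<eta>_def divide_neg_pos)
      obtain \<delta>' where \<delta>': "\<delta>' > 0" "\<And>y. norm (y - x\<^sub>0) < \<delta>' \<Longrightarrow>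
          norm (f\<^sub>0 y - f\<^sub>0 x\<^sub>0 - fderiv f\<^sub>0 x\<^sub>0 (y - x\<^sub>0)) \<le> \<eta> * norm (y - x\<^sub>0)"
        using Df \<eta> unfolding has_derivative_at_alt by blast
      have "\<forall>\<^sub>F t in at_right 0. 0 \<le> fderiv f\<^sub>0 x\<^sub>0 ((?x t - x\<^sub>0) /\<^sub>R t) + \<eta> * norm ((?x t - x\<^sub>0) /\<^sub>R t)"
        using pos better tendstoD[OF x_lim \<delta>'(1)]
      proof eventually_elim
        case (elim t)
        then have "0 \<le> fderiv f\<^sub>0 x\<^sub>0 (?x t - x\<^sub>0) + \<eta> * norm (?x t - x\<^sub>0)"
          using \<delta>'(2)[of "?x t"] unfolding dist_norm real_norm_def by linarith
        then have "0 \<le> (fderiv f\<^sub>0 x\<^sub>0 (?x t - x\<^sub>0) + \<eta> * norm (?x t - x\<^sub>0)) / t"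
          using elim(1) by simp
        moreover have "fderiv f\<^sub>0 x\<^sub>0 (u /\<^sub>R t) + \<eta> * norm (u /\<^sub>R t) = (fderiv f\<^sub>0 x\<^sub>0 u + \<eta> * norm u) / t" for u
          using elim(1) by (simp add: blinfun.scaleR_right divide_inverse algebra_simps)
        ultimately show ?case by simp
      qed
      moreover have "((\<lambda>t. fderiv f\<^sub>0 x\<^sub>0 ((?x t - x\<^sub>0) /\<^sub>R t) + \<eta> * norm ((?x t - x\<^sub>0) /\<^sub>R t))
          \<longlongrightarrow> fderiv f\<^sub>0 x\<^sub>0 d + \<eta> * norm d) (at_right 0)"
        by (intro tendsto_intros quot)
      ultimately have "0 \<le> fderiv f\<^sub>0 x\<^sub>0 d + \<eta> * norm d"
        by (intro tendsto_lowerbound) auto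
      also have "\<dots> \<le> fderiv f\<^sub>0 x\<^sub>0 d + \<eta> * (norm d + 1)" using \<eta> by simp
      also have "\<dots> = fderiv f\<^sub>0 x\<^sub>0 d / 2" using nd by (simp add: \<eta>_def field_simps)
      finally show False using neg by simp
    qed
  qed

  have adj_lin: "linear (adj ?A)"
    by (rule linearI) (auto intro!: blinfun_eqI simp: adj_def blinfun.add_left blinfun.scaleR_left inner_add_left)
  have "convex ?N"
    by (rule convexI) (auto simp: normal_cone_def inner_add_left intro!: add_nonpos_nonpos mult_nonneg_nonpos)
  then have M_convex: "convex (adj ?A ` ?N)" using adj_lin by (intro convex_linear_image)
  have M_cone: "cone (adj ?A ` ?N)"
    unfolding cone_def
    by (auto simp: linear_cmul[OF adj_lin, symmetric] normal_cone_def intro!: imageI mult_nonneg_nonpos)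
  have "- fderiv f\<^sub>0 x\<^sub>0 \<in> adj ?A ` ?N"
  proof (rule ccontr)
    assume "\<not> ?thesis"
    moreover have "adj ?A ` ?N \<noteq> {}" by (auto simp: normal_cone_def intro!: exI[of _ 0])
    ultimately obtain d where d: "\<And>\<psi>. \<psi> \<in> adj ?A ` ?N \<Longrightarrow> \<psi> d \<le> 0" "(- fderiv f\<^sub>0 x\<^sub>0) d > 0"
      using weak_star_separation[OF weak_star_closed M_convex M_cone _ _ biorthogonal] by blast
    have "l \<bullet> ?A d \<le> 0" if "l \<in> ?N" for l
      using d(1)[OF imageI[OF that]] by (simp add: adj_def)
    then have "d \<in> linearized_cone K G x\<^sub>0"
      using polar_of_normal_cone_tangent[of "G x\<^sub>0" I\<^sub>0 I\<^sub>1 "?A d"] x0_K indices(1)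
      by (simp add: linearized_cone_def K_def)
    then show False using descent[of d] d(2) by (simp add: blinfun.minus_left)
  qed
  then obtain l where "l \<in> ?N" "- fderiv f\<^sub>0 x\<^sub>0 = adj ?A l" by blast
  then have l: "l \<in> ?N" "fderiv f\<^sub>0 x\<^sub>0 + adj ?A l = 0"
    by (metis, metis add.right_inverse)
  have "((\<lambda>x. lagrangian f\<^sub>0 G x l) has_derivative (fderiv f\<^sub>0 x\<^sub>0 + adj ?A l)) (at x\<^sub>0)"
  proof -
    have "((\<lambda>x. f\<^sub>0 x + l \<bullet> G x) has_derivative (\<lambda>v. fderiv f\<^sub>0 x\<^sub>0 v + l \<bullet> ?A v)) (at x\<^sub>0)"
      by (intro has_derivative_add Df has_derivative_inner_right DG)
    moreover have "blinfun_apply (fderiv f\<^sub>0 x\<^sub>0 + adj ?A l) = (\<lambda>v. fderiv f\<^sub>0 x\<^sub>0 v + l \<bullet> ?A v)"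
      by (auto simp: blinfun.add_left adj_def)
    ultimately show ?thesis by (simp add: lagrangian_def)
  qed
  then have "fderiv (\<lambda>x. lagrangian f\<^sub>0 G x l) x\<^sub>0 = 0"
    unfolding l(2) by (rule fderiv_eqI)
  then show ?thesis using l by (auto simp: lagrange_multipliers_def)
qed

end
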